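(* There exists an upper semicontinuous multivalued function $S:[0,T]\times\mathbb{R}^n\rightrightarrows\mathbb{R}^2$ with nonempty images satisfying the following conditions: (S1) $S(T,x)=\{(\sigma_1(x),\sigma_2(x))\}$ for all $x\in\mathbb{R}^n$; (S2) for all $(t,x)\in[0,T]\times\mathbb{R}^n$, $(J_1,J_2)\in S(t,x)$, $u\in P$ and $t_+\in[t,T]$ there exist a motion $y^2(\cdot)\in\mathrm{Sol}^2(t,x;u)$ and a pair $(J_1',J_2')\in S(t_+,y^2(t_+))$ such that $J_1\geq J_1'$; (S3) for all $(t,x)\in[0,T]\times\mathbb{R}^n$, $(J_1,J_2)\in S(t,x)$, $v\in Q$ and $t_+\in[t,T]$ there exist a motion $y^1(\cdot)\in\mathrm{Sol}^1(t,x;v)$ and a pair $(J_1'',J_2'')\in S(t_+,y^1(t_+))$ such that $J_2\geq J_2''$; (S4) for all $(t,x)\in[0,T]\times\mathbb{R}^n$, $(J_1,J_2)\in S(t,x)$ and $t_+\in[t,T]$ there exists a motion $y^{(c)}(\cdot)\in\mathrm{Sol}(t,x)$ such that $(J_1,J_2)\in S(t_+,y^{(c)}(t_+))$.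
   Context: Consider the controlled system $\dot x=f(t,x,u)+g(t,x,v)$, $t\in[0,T]$, $x\in\mathbb{R}^n$, $u\in P$, $v\in Q$, and functions $\sigma_1,\sigma_2:\mathbb{R}^n\to\mathbb{R}$. The sets $P$ and $Q$ are (nonempty) compact; $f,g,\sigma_1,\sigma_2$ are continuous; $f$ and $g$ are Lipschitz continuous with respect to $x$ and satisfy the sublinear growth condition with respect to $x$. Let $\mathcal{U}$ (resp. $\mathcal{V}$) be the set of measurable functions $[0,T]\to P$ (resp. $[0,T]\to Q$). For $u\in\mathcal{U}$, $v\in\mathcal{V}$, $x(\cdot,t_0,x_0,u,v)$ is the solution of $\dot x(t)=f(t,x(t),u(t))+g(t,x(t),v(t))$, $x(t_0)=x_0$; an element of $P$ or $Q$ in place of $u$ or $v$ means the constant control. With closures taken in the space of continuous vector functions on $[0,T]$: $\mathrm{Sol}^1(t_*,x_*;v_* ):=\mathrm{cl}\{x(\cdot,t_*,x_*,u,v_* ):u\in\mathcal{U}\}$ for $v_*\in Q$; $\mathrm{Sol}^2(t_*,x_*;u_* ):=\mathrm{cl}\{x(\cdot,t_*,x_*,u_*,v):v\in\mathcal{V}\}$ for $u_*\in P$; $\mathrm{Sol}(t_*,x_* ):=\mathrm{cl}\{x(\cdot,t_*,x_*,u,v):u\in\mathcal{U},v\in\mathcal{V}\}$. Upper semicontinuity of a multivalued function is understood in the closed-graph sense: if $(t_l,x_l)\to(t,x)$, $J^l\in S(t_l,x_l)$ and $J^l\to J$, then $J\in S(t,x)$. *)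

theory Defs
  imports "HOL-Analysis.Analysis"
begin

text \<open>Lipschitz continuity in the state, with one constant for all times and controls.\<close>

definition lipschitz_in_state ::
  "real \<Rightarrow> 'p set \<Rightarrow> (real \<Rightarrow> real^'n \<Rightarrow> 'p \<Rightarrow> real^'n) \<Rightarrow> bool" where
  "lipschitz_in_state T P f \<longleftrightarrow>
     (\<exists>L. \<forall>t\<in>{0..T}. \<forall>u\<in>P. L-lipschitz_on UNIV (\<lambda>x. f t x u))"

definition sublinear_growth ::
  "real \<Rightarrow> 'p set \<Rightarrow> (real \<Rightarrow> real^'n \<Rightarrow> 'p \<Rightarrow> real^'n) \<Rightarrow> bool" where
  "sublinear_growth T P f \<longleftrightarrow>
     (\<exists>C. \<forall>t\<in>{0..T}. \<forall>x. \<forall>u\<in>P. norm (f t x u) \<le> C * (1 + norm x))"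

definition controls :: "real \<Rightarrow> 'p::topological_space set \<Rightarrow> (real \<Rightarrow> 'p) set" where
  "controls T P = lebesgue_on {0..T} \<rightarrow>\<^sub>M restrict_space borel P"

text \<open>The space of continuous functions on \<open>[0,T]\<close> with the uniform metric. Its points are
  \<open>extensional\<close>, so a function is determined by its restriction to \<open>[0,T]\<close>.\<close>

abbreviation path_space :: "real \<Rightarrow> (real \<Rightarrow> real^'n) metric" where
  "path_space T \<equiv> cfunspace (top_of_set {0..T}) euclidean_metric"

text \<open>Solutions for measurable controls are understood in the sense of Caratheodory. The
  integrated equation is required on every subinterval of \<open>[0,T]\<close>, hence the solution runs both
  forwards and backwards from \<open>t0\<close>.\<close>

definition is_motion ::
  "(real \<Rightarrow> real^'n \<Rightarrow> 'p \<Rightarrow> real^'n) \<Rightarrow> (real \<Rightarrow> real^'n \<Rightarrow> 'q \<Rightarrow> real^'n) \<Rightarrow> real \<Rightarrow>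
   real \<Rightarrow> real^'n \<Rightarrow> (real \<Rightarrow> 'p) \<Rightarrow> (real \<Rightarrow> 'q) \<Rightarrow> (real \<Rightarrow> real^'n) \<Rightarrow> bool" where
  "is_motion f g T t0 x0 u v x \<longleftrightarrow>
     x \<in> mspace (path_space T) \<and> x t0 = x0 \<and>
     (\<forall>a b. 0 \<le> a \<and> a \<le> b \<and> b \<le> T \<longrightarrow>
        ((\<lambda>s. f s (x s) (u s) + g s (x s) (v s)) has_integral (x b - x a)) {a..b})"

definition Sol1 ::
  "(real \<Rightarrow> real^'n \<Rightarrow> 'p::topological_space \<Rightarrow> real^'n) \<Rightarrow> (real \<Rightarrow> real^'n \<Rightarrow> 'q \<Rightarrow> real^'n) \<Rightarrow>
   real \<Rightarrow> 'p set \<Rightarrow> real \<Rightarrow> real^'n \<Rightarrow> 'q \<Rightarrow> (real \<Rightarrow> real^'n) set" where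
  "Sol1 f g T P t0 x0 v =
     mtopology_of (path_space T) closure_of
       {x. \<exists>u\<in>controls T P. is_motion f g T t0 x0 u (\<lambda>_. v) x}"

definition Sol2 ::
  "(real \<Rightarrow> real^'n \<Rightarrow> 'p \<Rightarrow> real^'n) \<Rightarrow> (real \<Rightarrow> real^'n \<Rightarrow> 'q::topological_space \<Rightarrow> real^'n) \<Rightarrow>
   real \<Rightarrow> 'q set \<Rightarrow> real \<Rightarrow> real^'n \<Rightarrow> 'p \<Rightarrow> (real \<Rightarrow> real^'n) set" where
  "Sol2 f g T Q t0 x0 u =
     mtopology_of (path_space T) closure_of
       {x. \<exists>v\<in>controls T Q. is_motion f g T t0 x0 (\<lambda>_. u) v x}"

definition Sol ::
  "(real \<Rightarrow> real^'n \<Rightarrow> 'p::topological_space \<Rightarrow> real^'n) \<Rightarrow>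
   (real \<Rightarrow> real^'n \<Rightarrow> 'q::topological_space \<Rightarrow> real^'n) \<Rightarrow>
   real \<Rightarrow> 'p set \<Rightarrow> 'q set \<Rightarrow> real \<Rightarrow> real^'n \<Rightarrow> (real \<Rightarrow> real^'n) set" where
  "Sol f g T P Q t0 x0 =
     mtopology_of (path_space T) closure_of
       {x. \<exists>u\<in>controls T P. \<exists>v\<in>controls T Q. is_motion f g T t0 x0 u v x}"

text \<open>Upper semicontinuity on \<open>[0,T] \<times> \<real>\<^sup>n\<close> in the closed-graph sense; values of \<open>S\<close> at times
  outside \<open>[0,T]\<close> are irrelevant.\<close>

definition upper_semicontinuous_mv ::
  "real \<Rightarrow> (real \<Rightarrow> real^'n \<Rightarrow> (real \<times> real) set) \<Rightarrow> bool" where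
  "upper_semicontinuous_mv T S \<longleftrightarrow>
     (\<forall>tl xl Jl t x J.
        (\<forall>l::nat. tl l \<in> {0..T} \<and> Jl l \<in> S (tl l) (xl l)) \<and>
        t \<in> {0..T} \<and> tl \<longlonglongrightarrow> t \<and> xl \<longlonglongrightarrow> x \<and> Jl \<longlonglongrightarrow> J \<longrightarrow> J \<in> S t x)"

end

theory Submission
  imports Defs "HOL-Complex_Analysis.Great_Picard"
begin

text \<open>
The function \<open>S\<close> is a limit of equilibrium payoffs of discrete games. Divide \<open>[0, T]\<close> into equal steps,
let the state move by Euler steps, and restrict the controls to finite nets of \<open>P\<close> and \<open>Q\<close>. In such a
finite game a single pair of payoffs \<open>W n k x\<close> is chosen at each node and state by backward induction:
each player takes the control with the best guaranteed payoff, and the resulting pair of controls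
determines the pair of payoffs. What a player receives in this way is at least what he can guarantee, and
his opponent can keep every other choice from yielding more (\<open>one_step_equilibrium\<close>). Hence along
suitable Euler runs the payoffs are constant, and after a deviation some reply of the opponent makes
the payoff of the deviating player nonincreasing. These are discrete
counterparts of the conditions on equilibrium motions and on deviations.

The graph of \<open>S\<close> is the upper limit of the graphs of \<open>W n\<close>, which is closed by construction. To see
that the conditions survive, let nodes and states converge to \<open>(t, x)\<close> and follow the Euler runs
that the discrete conditions provide. Their controls, extended to piecewise constant functions of time,
drive genuine motions from \<open>(t, x)\<close>; a constant deviation from the nets is replaced by the exact one.
These motions exist by \<open>picard_lindelof_measurable\<close> and stay uniformly close to the Euler runs
(\<open>euler_tracks_motion\<close>). By Arzela and Ascoli a subsequence converges to an element of the closure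
of the motions (\<open>euler_runs_accumulate\<close>); this is where it matters that the solution sets are
closures. The values along the way also have a convergent subsequence, because each of them is the
terminal payoff of an Euler run (\<open>values_accumulate\<close>). This yields nonemptiness,
the terminal condition and, in \<open>S_stable\<close>, the three stability conditions at once.
\<close>

section \<open>Differential equations with measurable right-hand side\<close>

lemma integral_diff_initial:
  fixes F :: "real \<Rightarrow> 'a::banach"
  assumes F: "F integrable_on {0..T}" and "0 \<le> a" "a \<le> b" "b \<le> T"
  shows "integral {0..b} F - integral {0..a} F = integral {a..b} F"
proof -
  have "F integrable_on {0..b}"
    by (rule integrable_subinterval_real[OF F]) (use assms in auto)
  from Henstock_Kurzweil_Integration.integral_combine[OF assms(2,3) this] show ?thesis
    by (simp add: algebra_simps)
qed

text \<open>Measured against the weight \<open>exp (K * \<bar>s - t0\<bar>)\<close>, integration from \<open>t0\<close> in either direction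
of time is a contraction by the factor \<open>1 / K\<close>.\<close>
lemma norm_integral_exp_bound:
  fixes F :: "real \<Rightarrow> 'a::euclidean_space"
  assumes F: "F integrable_on {0..T}" and t0: "t0 \<in> {0..T}" and t: "t \<in> {0..T}" and "K > 0"
    and c: "\<And>s. s \<in> {0..T} \<Longrightarrow> norm (F s) \<le> c * exp (K * \<bar>s - t0\<bar>)"
  shows "norm (integral {0..t} F - integral {0..t0} F) \<le> c / K * exp (K * \<bar>t - t0\<bar>)"
proof -
  have "0 \<le> c" using c[OF t0] norm_ge_zero[of "F t0"] by (simp del: norm_ge_zero)
  have *: "norm (integral {a..b} F) \<le> c / K * exp (K * (b - a))"
    if ab: "0 \<le> a" "a \<le> b" "b \<le> T" and "t0 = a \<or> t0 = b" for a b
  proof -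
    have Fab: "F integrable_on {a..b}"
      by (rule integrable_subinterval_real[OF F]) (use ab in auto)
    have "((\<lambda>s. c * exp (K * \<bar>s - t0\<bar>)) has_integral c / K * (exp (K * (b - a)) - 1)) {a..b}"
      using that(4)
    proof
      assume "t0 = a"
      have "((\<lambda>s. c * exp (K * (s - a))) has_integral
              c / K * exp (K * (b - a)) - c / K * exp (K * (a - a))) {a..b}"
        by (rule fundamental_theorem_of_calculus)
           (use ab \<open>K > 0\<close> in \<open>auto intro!: derivative_eq_intros
              simp flip: has_real_derivative_iff_has_vector_derivative\<close>)
      with \<open>t0 = a\<close> show ?thesis
        by (subst has_integral_cong[where g="\<lambda>s. c * exp (K * (s - a))"]) (auto simp: algebra_simps)
    next
      assume "t0 = b"
      have "((\<lambda>s. c * exp (K * (b - s))) has_integral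
              - c / K * exp (K * (b - b)) - - c / K * exp (K * (b - a))) {a..b}"
        by (rule fundamental_theorem_of_calculus)
           (use ab \<open>K > 0\<close> in \<open>auto intro!: derivative_eq_intros
              simp flip: has_real_derivative_iff_has_vector_derivative\<close>)
      with \<open>t0 = b\<close> show ?thesis
        by (subst has_integral_cong[where g="\<lambda>s. c * exp (K * (b - s))"]) (auto simp: algebra_simps)
    qed
    then have "norm (integral {a..b} F) \<le> c / K * (exp (K * (b - a)) - 1)"
      using integral_norm_bound_integral[OF Fab, of "\<lambda>s. c * exp (K * \<bar>s - t0\<bar>)"] c ab
      by (simp add: has_integral_iff)
    also have "\<dots> \<le> c / K * exp (K * (b - a))"
      using \<open>0 \<le> c\<close> \<open>K > 0\<close> by (intro mult_left_mono) auto
    finally show ?thesis .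
  qed
  have "norm (integral {0..t} F - integral {0..t0} F) = norm (integral {min t t0..max t t0} F)"
    using integral_diff_initial[OF F, of t t0] integral_diff_initial[OF F, of t0 t] t t0
      norm_minus_commute[of "integral {0..t} F" "integral {0..t0} F"]
    by (cases "t \<le> t0") (auto simp: min_def max_def)
  also have "\<dots> \<le> c / K * exp (K * (max t t0 - min t t0))"
    by (rule *) (use t t0 in auto)
  also have "max t t0 - min t t0 = \<bar>t - t0\<bar>" by auto
  finally show ?thesis .
qed

text \<open>The rescaling \<open>y s = exp (K * \<bar>s - t0\<bar>) * w s\<close> makes the Picard operator a contraction on the
bounded continuous functions, on the whole interval at once and in both directions of time, as
soon as \<open>K > 0\<close> is at least twice the Lipschitz constant. If it is also at least twice the growth
constant, the linear growth turns into \<open>norm w \<le> norm x0 + (1 + norm w) / 2\<close> and hence gives an a priori bound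
without a Gronwall argument. The right-hand side enters only through the integrability of
\<open>s \<mapsto> h s (y s)\<close>, so that controls may be discontinuous.\<close>
theorem picard_lindelof_measurable:
  fixes h :: "real \<Rightarrow> 'a::euclidean_space \<Rightarrow> 'a"
  assumes t0: "t0 \<in> {0..T}" and "0 \<le> L" "0 \<le> C"
    and lip: "\<And>s x y. s \<in> {0..T} \<Longrightarrow> norm (h s x - h s y) \<le> L * norm (x - y)"
    and growth: "\<And>s x. s \<in> {0..T} \<Longrightarrow> norm (h s x) \<le> C * (1 + norm x)"
    and int: "\<And>y. continuous_on {0..T} y \<Longrightarrow> (\<lambda>s. h s (y s)) integrable_on {0..T}"
  obtains y where "continuous_on {0..T} y" "y t0 = x0"
    "\<And>a b. \<lbrakk>0 \<le> a; a \<le> b; b \<le> T\<rbrakk> \<Longrightarrow> ((\<lambda>s. h s (y s)) has_integral (y b - y a)) {a..b}"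
    "\<And>s. s \<in> {0..T} \<Longrightarrow> norm (y s) \<le> exp ((2 * (L + C) + 1) * T) * (2 * norm x0 + 1)"
proof -
  define K where "K = 2 * (L + C) + 1"
  have K: "K > 0" "L / K \<le> 1/2" "C / K \<le> 1/2"
    using \<open>0 \<le> L\<close> \<open>0 \<le> C\<close> by (auto simp: K_def field_simps)
  define E where "E = (\<lambda>s. exp (K * \<bar>s - t0\<bar>))"
  have E: "E s > 0" "E s \<ge> 1" for s using K by (auto simp: E_def)
  have contE: "continuous_on A E" for A unfolding E_def by (intro continuous_intros)
  \<comment> \<open>Bounded continuous functions live on all of \<open>\<real>\<close>, hence the extension by \<open>clamp\<close> below.\<close>
  define F where "F = (\<lambda>(w::real \<Rightarrow>\<^sub>C 'a) s. h s (E s *\<^sub>R w s))"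
  have intF: "F w integrable_on {0..T}" for w
    unfolding F_def by (rule int) (intro continuous_intros contE continuous_on_apply_bcontfun)
  define Y where "Y = (\<lambda>w t. x0 + (integral {0..t} (F w) - integral {0..t0} (F w)))"
  have contY: "continuous_on {0..T} (Y w)" for w
    unfolding Y_def by (intro continuous_intros indefinite_integral_continuous_1 intF)
  have "\<exists>w'::real \<Rightarrow>\<^sub>C 'a. \<forall>t. w' t = inverse (E (clamp 0 T t)) *\<^sub>R Y w (clamp 0 T t)" for w
  proof -
    have "continuous_on {0..T} (\<lambda>t. inverse (E t) *\<^sub>R Y w t)"
      using E(1) by (intro continuous_on_scaleR continuous_on_inverse contE contY) (simp add: less_imp_neq[symmetric])
    then have "continuous_on (cbox 0 T) (\<lambda>t. inverse (E t) *\<^sub>R Y w t)" by simp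
    then obtain g :: "real \<Rightarrow>\<^sub>C 'a" where "\<And>t. g t = inverse (E (clamp 0 T t)) *\<^sub>R Y w (clamp 0 T t)"
      by (rule continuous_on_cbox_bcontfunE) blast
    then show ?thesis by blast
  qed
  then obtain \<Psi> :: "(real \<Rightarrow>\<^sub>C 'a) \<Rightarrow> (real \<Rightarrow>\<^sub>C 'a)"
    where \<Psi>: "\<And>w t. \<Psi> w t = inverse (E (clamp 0 T t)) *\<^sub>R Y w (clamp 0 T t)" by metis
  have clamp: "clamp 0 T t \<in> {0..T}" for t
    using clamp_in_interval[of 0 T t] t0 by simp
  have "dist (\<Psi> w) (\<Psi> w') \<le> 1/2 * dist w w'" for w w'
  proof (rule dist_bound)
    fix t
    define r where "r = clamp 0 T t"
    have r: "r \<in> {0..T}" using clamp by (simp add: r_def)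
    have "norm (F w s - F w' s) \<le> L * dist w w' * exp (K * \<bar>s - t0\<bar>)" if "s \<in> {0..T}" for s
    proof -
      have "norm (F w s - F w' s) \<le> L * norm (E s *\<^sub>R w s - E s *\<^sub>R w' s)"
        unfolding F_def by (rule lip[OF that])
      also have "\<dots> = L * (E s * dist (w s) (w' s))"
        using E(1)[of s] by (simp add: dist_norm flip: scaleR_diff_right)
      also have "\<dots> \<le> L * (E s * dist w w')"
        using E(1)[of s] \<open>0 \<le> L\<close> by (intro mult_left_mono dist_bounded) auto
      finally show ?thesis by (simp add: E_def mult_ac)
    qed
    then have "norm (integral {0..r} (\<lambda>s. F w s - F w' s) - integral {0..t0} (\<lambda>s. F w s - F w' s))
        \<le> L * dist w w' / K * exp (K * \<bar>r - t0\<bar>)"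
      by (rule norm_integral_exp_bound[OF integrable_diff[OF intF intF] t0 r K(1)])
    moreover have "integral {0..a} (\<lambda>s. F w s - F w' s) = integral {0..a} (F w) - integral {0..a} (F w')"
      if "a \<in> {0..T}" for a
      by (rule integral_diff) (use that in \<open>auto intro: integrable_subinterval_real[OF intF]\<close>)
    ultimately have "norm ((integral {0..r} (F w) - integral {0..r} (F w'))
        - (integral {0..t0} (F w) - integral {0..t0} (F w'))) \<le> L * dist w w' / K * E r"
      using r t0 by (simp add: E_def)
    moreover have "Y w r - Y w' r = (integral {0..r} (F w) - integral {0..r} (F w'))
        - (integral {0..t0} (F w) - integral {0..t0} (F w'))"
      by (simp add: Y_def)
    ultimately have "norm (Y w r - Y w' r) \<le> L * dist w w' / K * E r" by simp
    also have "\<dots> = (L / K) * (dist w w' * E r)" by simp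
    also have "\<dots> \<le> 1/2 * (dist w w' * E r)"
      using K(2) E(1)[of r] by (intro mult_right_mono) auto
    finally have "norm (Y w r - Y w' r) \<le> 1/2 * dist w w' * E r" by simp
    moreover have "dist (\<Psi> w t) (\<Psi> w' t) = norm (Y w r - Y w' r) / E r"
      using E(1)[of r] unfolding \<Psi> dist_norm r_def[symmetric] scaleR_diff_right[symmetric] norm_scaleR
      by (simp add: field_simps)
    ultimately show "dist (\<Psi> w t) (\<Psi> w' t) \<le> 1/2 * dist w w'"
      using E(1)[of r] by (simp add: pos_divide_le_eq)
  qed
  then obtain w where w: "\<Psi> w = w"
    using banach_fix_type[of "1/2" \<Psi>] by auto
  define y where "y = (\<lambda>t. E t *\<^sub>R w t)"
  have yY: "y t = Y w t" if "t \<in> {0..T}" for t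
  proof -
    have "clamp 0 T t = t" using that by (intro clamp_cancel_cbox) auto
    then have "w t = inverse (E t) *\<^sub>R Y w t" using \<Psi>[of w t] w by simp
    then show ?thesis using E(1)[of t] by (simp add: y_def)
  qed
  have Fy: "F w = (\<lambda>s. h s (y s))" by (auto simp: F_def y_def)
  show thesis
  proof (rule that)
    show "continuous_on {0..T} y" unfolding y_def by (intro continuous_intros contE continuous_on_apply_bcontfun)
    show "y t0 = x0" using yY[OF t0] by (simp add: Y_def)
    show "((\<lambda>s. h s (y s)) has_integral (y b - y a)) {a..b}" if "0 \<le> a" "a \<le> b" "b \<le> T" for a b
    proof -
      have "integral {0..b} (F w) - integral {0..a} (F w) = integral {a..b} (F w)"
        by (rule integral_diff_initial[OF intF that])
      moreover have "F w integrable_on {a..b}"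
        by (rule integrable_subinterval_real[OF intF]) (use that in auto)
      ultimately show ?thesis
        using yY[of a] yY[of b] that unfolding Fy[symmetric] by (simp add: Y_def has_integral_iff)
    qed
    have "norm w \<le> norm x0 + C * (1 + norm w) / K"
    proof (rule norm_bound)
      fix t
      define r where "r = clamp 0 T t"
      have r: "r \<in> {0..T}" using clamp by (simp add: r_def)
      have "norm (F w s) \<le> C * (1 + norm w) * exp (K * \<bar>s - t0\<bar>)" if "s \<in> {0..T}" for s
      proof -
        have "norm (F w s) \<le> C * (1 + norm (E s *\<^sub>R w s))"
          unfolding F_def by (rule growth[OF that])
        also have "1 + norm (E s *\<^sub>R w s) \<le> E s * (1 + norm w)"
        proof -
          have "norm (E s *\<^sub>R w s) \<le> E s * norm w"
            using E(1)[of s] mult_left_mono[OF norm_bounded[of w s], of "E s"] by simp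
          with E(2)[of s] show ?thesis unfolding distrib_left mult_1_right by linarith
        qed
        finally have "norm (F w s) \<le> C * (E s * (1 + norm w))"
          using \<open>0 \<le> C\<close> by (simp add: mult_left_mono)
        then show ?thesis by (simp add: E_def mult_ac)
      qed
      then have "norm (integral {0..r} (F w) - integral {0..t0} (F w))
          \<le> C * (1 + norm w) / K * exp (K * \<bar>r - t0\<bar>)"
        by (rule norm_integral_exp_bound[OF intF t0 r K(1)])
      then have "norm (Y w r) \<le> norm x0 * 1 + C * (1 + norm w) / K * E r"
        unfolding Y_def E_def mult_1_right by (rule norm_triangle_mono[OF order_refl])
      also have "\<dots> \<le> norm x0 * E r + C * (1 + norm w) / K * E r"
        using E(2)[of r] by (intro add_right_mono mult_left_mono) auto
      finally have "norm (Y w r) \<le> (norm x0 + C * (1 + norm w) / K) * E r"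
        by (simp add: algebra_simps)
      then have "norm (Y w r) / E r \<le> norm x0 + C * (1 + norm w) / K"
        using E(1)[of r] by (simp only: pos_divide_le_eq)
      moreover have "norm (w t) = norm (Y w r) / E r"
        using \<Psi>[of w t] E(1)[of r] by (simp add: w r_def divide_inverse)
      ultimately show "norm (w t) \<le> norm x0 + C * (1 + norm w) / K" by simp
    qed
    also have "C * (1 + norm w) / K = C / K * (1 + norm w)" by simp
    also have "\<dots> \<le> 1/2 * (1 + norm w)"
      using K(3) by (intro mult_right_mono) auto
    finally have w_le: "norm w \<le> 2 * norm x0 + 1" by (simp add: field_simps)
    show "norm (y s) \<le> exp ((2 * (L + C) + 1) * T) * (2 * norm x0 + 1)" if "s \<in> {0..T}" for s
    proof -
      have "norm (y s) = E s * norm (w s)" using E(1)[of s] by (simp add: y_def)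
      also have "\<dots> \<le> exp (K * T) * (2 * norm x0 + 1)"
        using that t0 K w_le norm_bounded[of w s] by (intro mult_mono) (auto simp: E_def)
      finally show ?thesis by (simp add: K_def)
    qed
  qed
qed

section \<open>The error of an Euler polygon\<close>

text \<open>The discrete Gronwall inequality for an integral curve \<open>y\<close> and an Euler polygon \<open>z\<close>. The velocity
may jump at a node, so the hypothesis on it excludes the right end point of each cell.\<close>
lemma euler_error:
  fixes y F :: "real \<Rightarrow> 'a::euclidean_space" and z G :: "nat \<Rightarrow> 'a"
  assumes "0 \<le> h" "0 \<le> L" "0 \<le> \<eta>" and ki: "k \<le> i" "i \<le> n"
    and int: "\<And>i. \<lbrakk>k \<le> i; i < n\<rbrakk> \<Longrightarrow>
      (F has_integral (y (real (Suc i) * h) - y (real i * h))) {real i * h..real (Suc i) * h}"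
    and z: "\<And>i. \<lbrakk>k \<le> i; i < n\<rbrakk> \<Longrightarrow> z (Suc i) = z i + h *\<^sub>R G i"
    and close: "\<And>i s. \<lbrakk>k \<le> i; i < n; real i * h \<le> s; s < real (Suc i) * h\<rbrakk> \<Longrightarrow>
      norm (F s - G i) \<le> \<eta> + L * norm (y (real i * h) - z i)"
  shows "norm (y (real i * h) - z i) \<le>
    (1 + L * h) ^ (i - k) * (norm (y (real k * h) - z k) + real (i - k) * h * \<eta>)"
  using ki
proof (induction i rule: dec_induct)
  case base
  then show ?case by simp
next
  case (step i)
  let ?e = "\<lambda>i. norm (y (real i * h) - z i)"
  let ?a = "(1 + L * h) ^ (i - k)"
  have "((\<lambda>s. F s - G i) has_integral (y (real (Suc i) * h) - y (real i * h) - h *\<^sub>R G i))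
          {real i * h..real (Suc i) * h}"
    using has_integral_diff[OF int[of i] has_integral_const_real[of "G i" "real i * h" "real (Suc i) * h"]]
      step \<open>0 \<le> h\<close> by (simp add: algebra_simps)
  from has_integral_bound_spike_finite[where S="{real (Suc i) * h}", OF _ _ this[folded cbox_interval],
      of "\<eta> + L * ?e i"]
  have "norm (y (real (Suc i) * h) - y (real i * h) - h *\<^sub>R G i) \<le> (\<eta> + L * ?e i) * h"
    using step close[of i] assms(1-3) by (force simp: algebra_simps)
  moreover have "y (real (Suc i) * h) - z (Suc i) =
      (y (real (Suc i) * h) - y (real i * h) - h *\<^sub>R G i) + (y (real i * h) - z i)"
    using z[of i] step by simp
  ultimately have "?e (Suc i) \<le> (\<eta> + L * ?e i) * h + ?e i"
    by (metis (no_types, lifting) norm_triangle_mono order_refl)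
  also have "\<dots> = (1 + L * h) * ?e i + h * \<eta>" by (simp add: algebra_simps)
  also have "\<dots> \<le> (1 + L * h) * (?a * (?e k + real (i - k) * h * \<eta>)) + h * \<eta>"
    using step assms(1-2) by (intro add_right_mono mult_left_mono) auto
  also have "\<dots> = (1 + L * h) ^ (Suc i - k) * (?e k + real (i - k) * h * \<eta>) + 1 * (h * \<eta>)"
    using step by (simp add: Suc_diff_le)
  also have "\<dots> \<le> (1 + L * h) ^ (Suc i - k) * (?e k + real (i - k) * h * \<eta>)
                + (1 + L * h) ^ (Suc i - k) * (h * \<eta>)"
    using assms(1-3) by (intro add_left_mono mult_right_mono one_le_power) auto
  also have "\<dots> = (1 + L * h) ^ (Suc i - k) * (?e k + real (Suc i - k) * h * \<eta>)"
    using step by (simp add: Suc_diff_le algebra_simps)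
  finally show ?case .
qed

section \<open>Backward induction for finite two-person games\<close>

text \<open>If \<open>u0\<close> maximises the payoff that the first player can guarantee and \<open>v0\<close> does the same for the
second player, then the pair \<open>(u0, v0)\<close> pays each player at least his guaranteed payoff. An
opponent can hold any other choice down to the guaranteed payoff of that choice, which is
no larger. The reply may depend on the deviation, which is why no saddle point has to exist.\<close>
lemma one_step_equilibrium:
  fixes w :: "'a \<Rightarrow> 'b \<Rightarrow> real \<times> real"
  assumes "finite A" "A \<noteq> {}" "finite B" "B \<noteq> {}"
  shows "\<exists>c. (\<exists>u\<in>A. \<exists>v\<in>B. w u v = c) \<and>
             (\<forall>u\<in>A. \<exists>v\<in>B. fst (w u v) \<le> fst c) \<and>
             (\<forall>v\<in>B. \<exists>u\<in>A. snd (w u v) \<le> snd c)"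
proof -
  define m1 where "m1 u = Min ((\<lambda>v. fst (w u v)) ` B)" for u
  define m2 where "m2 v = Min ((\<lambda>u. snd (w u v)) ` A)" for v
  obtain u0 where u0: "u0 \<in> A" "m1 u0 = Max (m1 ` A)"
    using obtains_MAX[OF assms(1,2), of m1] by metis
  obtain v0 where v0: "v0 \<in> B" "m2 v0 = Max (m2 ` B)"
    using obtains_MAX[OF assms(3,4), of m2] by metis
  have "\<exists>v\<in>B. fst (w u v) \<le> fst (w u0 v0)" if "u \<in> A" for u
  proof -
    obtain v where v: "v \<in> B" "fst (w u v) = m1 u"
      using obtains_MIN[OF assms(3,4), of "\<lambda>v. fst (w u v)"] by (metis m1_def)
    have "m1 u \<le> m1 u0" using u0 that assms by simp
    also have "m1 u0 \<le> fst (w u0 v0)" using v0 assms by (simp add: m1_def)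
    finally show ?thesis using v by (intro bexI[of _ v]) simp_all
  qed
  moreover have "\<exists>u\<in>A. snd (w u v) \<le> snd (w u0 v0)" if "v \<in> B" for v
  proof -
    obtain u where u: "u \<in> A" "snd (w u v) = m2 v"
      using obtains_MIN[OF assms(1,2), of "\<lambda>u. snd (w u v)"] by (metis m2_def)
    have "m2 v \<le> m2 v0" using v0 that assms by simp
    also have "m2 v0 \<le> snd (w u0 v0)" using u0 assms by (simp add: m2_def)
    finally show ?thesis using u by (intro bexI[of _ u]) simp_all
  qed
  ultimately show ?thesis using u0 v0 by blast
qed

lemma backward_induction:
  fixes move :: "nat \<Rightarrow> 'x \<Rightarrow> 'a \<Rightarrow> 'b \<Rightarrow> 'x" and \<sigma> :: "'x \<Rightarrow> real \<times> real"
  assumes "finite A" "A \<noteq> {}" "finite B" "B \<noteq> {}"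
  shows "\<exists>W. W N = \<sigma> \<and> (\<forall>k<N. \<forall>x.
    (\<exists>u\<in>A. \<exists>v\<in>B. W (Suc k) (move k x u v) = W k x) \<and>
    (\<forall>u\<in>A. \<exists>v\<in>B. fst (W (Suc k) (move k x u v)) \<le> fst (W k x)) \<and>
    (\<forall>v\<in>B. \<exists>u\<in>A. snd (W (Suc k) (move k x u v)) \<le> snd (W k x)))"
proof -
  define fair where "fair k w x c \<longleftrightarrow>
    (\<exists>u\<in>A. \<exists>v\<in>B. w (move k x u v) = c) \<and>
    (\<forall>u\<in>A. \<exists>v\<in>B. fst (w (move k x u v)) \<le> fst c) \<and>
    (\<forall>v\<in>B. \<exists>u\<in>A. snd (w (move k x u v)) \<le> snd c)" for k x c and w :: "'x \<Rightarrow> real \<times> real"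
  define \<Phi> where "\<Phi> k w x = (SOME c. fair k w x c)" for k x w
  have "\<exists>c. fair k w x c" for k w x
    unfolding fair_def by (rule one_step_equilibrium[OF assms, where w="\<lambda>u v. w (move k x u v)"])
  then have \<Phi>: "fair k w x (\<Phi> k w x)" for k w x
    unfolding \<Phi>_def by (rule someI_ex)
  define V where "V = rec_nat \<sigma> (\<lambda>j w. \<Phi> (N - Suc j) w)"
  define W where "W k = V (N - k)" for k
  have "W k = \<Phi> k (W (Suc k))" if "k < N" for k
  proof -
    have "N - k = Suc (N - Suc k)" "N - Suc (N - Suc k) = k" using that by auto
    then show ?thesis by (simp add: W_def V_def)
  qed
  moreover have "W N = \<sigma>" by (simp add: W_def V_def)
  ultimately have "W N = \<sigma> \<and> (\<forall>k<N. \<forall>x. fair k (W (Suc k)) x (W k x))"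
    using \<Phi> by simp
  then show ?thesis unfolding fair_def by blast
qed

text \<open>Open-loop sequences generated by a feedback that chooses moves with the property \<open>R\<close>.\<close>
lemma follow_feedback:
  fixes move :: "nat \<Rightarrow> 'x \<Rightarrow> 'a \<Rightarrow> 'b \<Rightarrow> 'x"
  assumes "\<And>i x. \<exists>u\<in>A. \<exists>v\<in>B. R i x u v"
  obtains z :: "nat \<Rightarrow> 'x" and u v where "z k = x"
    "\<And>i. u i \<in> A" "\<And>i. v i \<in> B"
    "\<And>i. k \<le> i \<Longrightarrow> z (Suc i) = move i (z i) (u i) (v i)"
    "\<And>i. R i (z i) (u i) (v i)"
proof -
  obtain \<alpha> \<beta> where ab: "\<And>i x. \<alpha> i x \<in> A" "\<And>i x. \<beta> i x \<in> B" "\<And>i x. R i x (\<alpha> i x) (\<beta> i x)"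
    using assms by metis
  define Z where "Z = rec_nat x (\<lambda>j y. move (k + j) y (\<alpha> (k + j) y) (\<beta> (k + j) y))"
  define z where "z i = Z (i - k)" for i
  show thesis
  proof (rule that[of z "\<lambda>i. \<alpha> i (z i)" "\<lambda>i. \<beta> i (z i)"])
    show "z (Suc i) = move i (z i) (\<alpha> i (z i)) (\<beta> i (z i))" if "k \<le> i" for i
      using that by (simp add: z_def Z_def Suc_diff_le)
  qed (auto simp: z_def Z_def ab)
qed

section \<open>Nets and the path space\<close>

lemma finite_net:
  fixes P :: "'a::metric_space set"
  assumes "compact P" "P \<noteq> {}" "e > 0"
  shows "\<exists>F. finite F \<and> F \<noteq> {} \<and> F \<subseteq> P \<and> (\<forall>u\<in>P. \<exists>u'\<in>F. dist u u' < e)"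
proof -
  obtain F where F: "finite F" "F \<subseteq> P" "P \<subseteq> (\<Union>x\<in>F. ball x e)"
    using assms seq_compact_imp_totally_bounded[OF compact_imp_seq_compact, of P] by blast
  moreover have "F \<noteq> {}" using F assms(2) by auto
  moreover have "\<exists>u'\<in>F. dist u u' < e" if "u \<in> P" for u
    using subsetD[OF F(3) that] by (auto simp: dist_commute)
  ultimately show ?thesis by blast
qed

lemma dist_Pair_le: "dist (p, q) (p', q') \<le> dist p p' + dist q q'"
  by (simp add: dist_Pair_Pair sqrt_sum_squares_le_sum)

lemma dist_triple_less:
  assumes "dist a a' < d / 3" "dist b b' < d / 3" "dist c c' < d / 3"
  shows "dist (a, b, c) (a', b', c') < d"
proof -
  show ?thesis
    using dist_Pair_le[of a "(b, c)" a' "(b', c')"] dist_Pair_le[of b c b' c'] assms by linarith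
qed

lemma mem_path_space:
  "y \<in> mspace (path_space T) \<longleftrightarrow> y \<in> extensional {0..T} \<and> continuous_on {0..T} y"
proof -
  have "compactin (top_of_set {0..T}) (topspace (top_of_set {0..T}))"
    by (simp add: compactin_subtopology compactin_euclidean_iff)
  from compactin_mspace_cfunspace[OF this]
  have "mspace (path_space T) = {f :: real \<Rightarrow> real^'n. (\<forall>x\<in>topspace (top_of_set {0..T}). f x \<in> mspace euclidean_metric) \<and>
      f \<in> extensional (topspace (top_of_set {0..T})) \<and> continuous_map (top_of_set {0..T}) (mtopology_of euclidean_metric) f}" .
  then show ?thesis by (auto simp del: mspace_cfunspace)
qed

lemma uniform_approx_in_closure:
  assumes "0 \<le> T" "y \<in> mspace (path_space T)" "A \<subseteq> mspace (path_space T)"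
    and approx: "\<And>e. e > 0 \<Longrightarrow> \<exists>w\<in>A. \<forall>s\<in>{0..T}. norm (w s - y s) < e"
  shows "y \<in> mtopology_of (path_space T) closure_of A"
proof -
  interpret M: Metric_space "mspace (path_space T)" "mdist (path_space T)"
    by (rule Metric_space_mspace_mdist)
  have "\<exists>w\<in>A. w \<in> M.mball y r" if "r > 0" for r
  proof -
    obtain w where w: "w \<in> A" "\<forall>s\<in>{0..T}. norm (w s - y s) < r / 2"
      using approx[of "r / 2"] \<open>r > 0\<close> by auto
    have "mdist (path_space T) y w \<le> r / 2"
      using cfunspace_mdist_le[of y "top_of_set {0..T}" euclidean_metric w "r / 2"] w assms
      by (auto simp: dist_norm norm_minus_commute less_imp_le simp del: mspace_cfunspace)
    then have "w \<in> M.mball y r"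
      using w assms \<open>r > 0\<close> by (auto simp: M.in_mball simp del: mspace_cfunspace)
    with w show ?thesis by blast
  qed
  then show ?thesis
    using assms by (auto simp: mtopology_of_def M.metric_closure_of simp del: mspace_cfunspace)
qed

section \<open>Motions under piecewise constant controls\<close>

locale controlled_system =
  fixes T :: real
    and P :: "'p::metric_space set" and Q :: "'q::metric_space set"
    and f :: "real \<Rightarrow> real^'n \<Rightarrow> 'p \<Rightarrow> real^'n"
    and g :: "real \<Rightarrow> real^'n \<Rightarrow> 'q \<Rightarrow> real^'n"
    and L C :: real
  assumes T: "0 \<le> T"
    and compact: "compact P" "compact Q"
    and cont_f: "continuous_on ({0..T} \<times> UNIV \<times> P) (\<lambda>(t, x, u). f t x u)"
    and cont_g: "continuous_on ({0..T} \<times> UNIV \<times> Q) (\<lambda>(t, x, v). g t x v)"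
    and L: "0 \<le> L" and C: "0 \<le> C"
    and lip_f: "\<lbrakk>s \<in> {0..T}; u \<in> P\<rbrakk> \<Longrightarrow> norm (f s x u - f s y u) \<le> L * norm (x - y)"
    and lip_g: "\<lbrakk>s \<in> {0..T}; v \<in> Q\<rbrakk> \<Longrightarrow> norm (g s x v - g s y v) \<le> L * norm (x - y)"
    and growth_f: "\<lbrakk>s \<in> {0..T}; u \<in> P\<rbrakk> \<Longrightarrow> norm (f s x u) \<le> C * (1 + norm x)"
    and growth_g: "\<lbrakk>s \<in> {0..T}; v \<in> Q\<rbrakk> \<Longrightarrow> norm (g s x v) \<le> C * (1 + norm x)"
begin

text \<open>The time grid has the \<open>Suc n\<close> cells \<open>[grid n i, grid n (Suc i))\<close>, and \<open>cell n s\<close> is the number of the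
cell that contains \<open>s\<close>. A piecewise constant control is the composition of a sequence of values
with \<open>cell n\<close>. At \<open>s = T > 0\<close> the cell number is \<open>Suc n\<close>; for \<open>T = 0\<close> all nodes coincide, division by
zero gives the cell number \<open>0\<close>, and all cells are empty.\<close>
definition step :: "nat \<Rightarrow> real" where "step n = T / real (Suc n)"
definition grid :: "nat \<Rightarrow> nat \<Rightarrow> real" where "grid n k = real k * step n"
definition cell :: "nat \<Rightarrow> real \<Rightarrow> nat" where "cell n s = nat \<lfloor>s / step n\<rfloor>"

definition euler_move :: "nat \<Rightarrow> nat \<Rightarrow> real^'n \<Rightarrow> 'p \<Rightarrow> 'q \<Rightarrow> real^'n" where
  "euler_move n i x u v = x + step n *\<^sub>R (f (grid n i) x u + g (grid n i) x v)"

lemma step_nonneg: "0 \<le> step n" using T by (simp add: step_def)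

lemma grid_last: "grid n (Suc n) = T" by (simp add: grid_def step_def)

lemma grid_mono: "i \<le> j \<Longrightarrow> grid n i \<le> grid n j"
  using step_nonneg by (simp add: grid_def mult_right_mono)

lemma grid_in: "k \<le> Suc n \<Longrightarrow> grid n k \<in> {0..T}"
  using grid_mono[of k "Suc n" n] grid_last step_nonneg by (simp add: grid_def)

lemma cell_eq: "\<lbrakk>grid n i \<le> s; s < grid n (Suc i)\<rbrakk> \<Longrightarrow> cell n s = i"
proof -
  assume s: "grid n i \<le> s" "s < grid n (Suc i)"
  then have "step n > 0" using step_nonneg[of n] by (auto simp: grid_def algebra_simps)
  then have "\<lfloor>s / step n\<rfloor> = int i"
    using s by (intro floor_unique) (auto simp: grid_def field_simps)
  then show ?thesis by (simp add: cell_def)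
qed

lemma step_tendsto_0: "filterlim n at_top F \<Longrightarrow> ((\<lambda>j. step (n j)) \<longlongrightarrow> 0) F"
proof -
  assume "filterlim n at_top F"
  moreover have "(\<lambda>n. step n) \<longlonglongrightarrow> 0"
    unfolding step_def using LIMSEQ_Suc[OF lim_const_over_n] .
  ultimately show ?thesis by (rule filterlim_compose[rotated])
qed

text \<open>Nodes that are not earlier than a given node \<open>grid n k\<close> suffice to approximate times \<open>t' \<ge> t\<close>: if
\<open>grid n k\<close> overshoots \<open>t'\<close>, then \<open>t \<le> t' \<le> grid n k\<close>, and the node \<open>k\<close> itself is near enough.\<close>
lemma grid_point_near:
  assumes "t' \<in> {0..T}" "k \<le> Suc n" "t \<le> t'"
  obtains m where "k \<le> m" "m \<le> Suc n" "\<bar>grid n m - t'\<bar> \<le> \<bar>grid n k - t\<bar> + step n"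
proof (cases "t' \<le> grid n k")
  case True
  with assms that[of k] step_nonneg[of n] show thesis by auto
next
  case False
  then have "T > 0" using assms grid_in[of k n] by auto
  then have h: "step n > 0" by (simp add: step_def)
  define m where "m = cell n t'"
  have m: "real m = of_int \<lfloor>t' / step n\<rfloor>"
    using assms h by (simp add: m_def cell_def)
  have m1: "real m \<le> t' / step n" "t' / step n < real m + 1"
    unfolding m by linarith+
  have "real k \<le> t' / step n" using False h by (simp add: grid_def field_simps)
  then have "k \<le> m" using m1 by linarith
  moreover have "t' / step n \<le> T / step n" using assms h by (simp add: divide_right_mono)
  then have "real m \<le> real (Suc n)" using m1 \<open>T > 0\<close> by (simp add: step_def)
  then have "m \<le> Suc n" by linarith
  moreover have "\<bar>grid n m - t'\<bar> \<le> step n"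
    using m1 h by (auto simp: grid_def field_simps abs_le_iff)
  then have "\<bar>grid n m - t'\<bar> \<le> \<bar>grid n k - t\<bar> + step n" by linarith
  ultimately show thesis using that by blast
qed

lemma measurable_cell: "cell n \<in> lebesgue_on {0..T} \<rightarrow>\<^sub>M count_space UNIV"
proof -
  have "(\<lambda>s::real. s) \<in> borel_measurable (lebesgue_on {0..T})"
    using id_borel_measurable_lebesgue_on by (simp add: id_def)
  moreover have "cell n \<in> borel \<rightarrow>\<^sub>M count_space UNIV"
    unfolding cell_def[abs_def] by measurable
  ultimately show ?thesis by (rule measurable_compose)
qed

lemma piecewise_constant_control:
  assumes "\<And>i. a i \<in> A"
  shows "(\<lambda>s. a (cell n s)) \<in> controls T A"
  unfolding controls_def
  by (rule measurable_compose[OF measurable_cell]) (use assms in \<open>auto simp: space_restrict_space\<close>)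

text \<open>Only countably many control values occur, so measurability reduces to that of the continuous
functions \<open>s \<mapsto> F s (y s) (a i)\<close>.\<close>
lemma piecewise_integrable:
  fixes F :: "real \<Rightarrow> real^'n \<Rightarrow> 'c::metric_space \<Rightarrow> real^'n"
  assumes F: "continuous_on ({0..T} \<times> UNIV \<times> A) (\<lambda>(t, x, u). F t x u)"
    and bnd: "\<And>s x u. \<lbrakk>s \<in> {0..T}; u \<in> A\<rbrakk> \<Longrightarrow> norm (F s x u) \<le> C * (1 + norm x)"
    and a: "\<And>i. a i \<in> A" and y: "continuous_on {0..T} y"
  shows "(\<lambda>s. F s (y s) (a (cell n s))) integrable_on {0..T}"
proof (rule measurable_bounded_by_integrable_imp_integrable)
  have "(\<lambda>s. F s (y s) (a i)) \<in> borel_measurable (lebesgue_on {0..T})" for i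
  proof (rule continuous_imp_measurable_on_sets_lebesgue)
    show "continuous_on {0..T} (\<lambda>s. F s (y s) (a i))"
    proof -
      have "continuous_on {0..T} (\<lambda>s. (s, y s, a i))" by (intro continuous_intros y)
      from continuous_on_compose2[OF F this] a show ?thesis by auto
    qed
  qed simp
  then show "(\<lambda>s. F s (y s) (a (cell n s))) \<in> borel_measurable (lebesgue_on {0..T})"
    by (rule measurable_compose_countable[OF _ measurable_cell])
  show "(\<lambda>s. C * (1 + norm (y s))) integrable_on {0..T}"
    by (intro integrable_continuous_interval continuous_intros y)
qed (use a bnd in auto)

text \<open>The a priori bound of the Picard theorem for the sum of the two dynamics, and the resulting bound
for the velocity. Both depend on the initial state alone, not on the controls, which makes the
family of motions from a fixed point bounded and equicontinuous.\<close>
definition radius :: "real^'n \<Rightarrow> real" where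
  "radius x = exp ((2 * (2 * L + 2 * C) + 1) * T) * (2 * norm x + 1)"

definition speed :: "real^'n \<Rightarrow> real" where
  "speed x = 2 * C * (1 + radius x)"

lemma speed_nonneg: "0 \<le> speed x"
  using C by (simp add: speed_def radius_def)

lemma motion_exists:
  assumes t: "t \<in> {0..T}" and a: "\<And>i. a i \<in> P" and b: "\<And>i. b i \<in> Q"
  obtains y where "is_motion f g T t x (\<lambda>s. a (cell n s)) (\<lambda>s. b (cell n s)) y"
    "\<And>s. s \<in> {0..T} \<Longrightarrow> norm (y s) \<le> radius x"
    "\<And>s s'. \<lbrakk>s \<in> {0..T}; s' \<in> {0..T}\<rbrakk> \<Longrightarrow> norm (y s - y s') \<le> speed x * \<bar>s - s'\<bar>"
proof -
  let ?h = "\<lambda>s x. f s x (a (cell n s)) + g s x (b (cell n s))"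
  have growth: "norm (?h s x) \<le> 2 * C * (1 + norm x)" if "s \<in> {0..T}" for s x
    using norm_triangle_mono[OF growth_f[OF that a[of "cell n s"], of x] growth_g[OF that b[of "cell n s"], of x]]
    by (simp add: algebra_simps)
  have lip: "norm (?h s x - ?h s y) \<le> 2 * L * norm (x - y)" if "s \<in> {0..T}" for s x y
    proof -
      have "?h s x - ?h s y = (f s x (a (cell n s)) - f s y (a (cell n s)))
          + (g s x (b (cell n s)) - g s y (b (cell n s)))" by simp
      also have "norm \<dots> \<le> 2 * L * norm (x - y)"
        using norm_triangle_mono[OF lip_f[OF that a[of "cell n s"], of x y] lip_g[OF that b[of "cell n s"], of x y]] by simp
      finally show ?thesis .
    qed
  have int: "(\<lambda>s. ?h s (y s)) integrable_on {0..T}" if "continuous_on {0..T} y" for y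
      by (rule integrable_add[OF piecewise_integrable[OF cont_f growth_f a that]
          piecewise_integrable[OF cont_g growth_g b that]])
  have "0 \<le> 2 * L" "0 \<le> 2 * C" using L C by auto
  from picard_lindelof_measurable[where h="?h" and ?x0.0=x, OF t this lip growth int]
  obtain y where y: "continuous_on {0..T} y" "y t = x"
    and int: "\<And>a b. \<lbrakk>0 \<le> a; a \<le> b; b \<le> T\<rbrakk> \<Longrightarrow> ((\<lambda>s. ?h s (y s)) has_integral (y b - y a)) {a..b}"
    and bnd: "\<And>s. s \<in> {0..T} \<Longrightarrow> norm (y s) \<le> radius x"
    unfolding radius_def by blast
  have lip: "norm (y s' - y s) \<le> speed x * (s' - s)" if "0 \<le> s" "s \<le> s'" "s' \<le> T" for s s'
  proof -
    have "norm (?h r (y r)) \<le> speed x" if "r \<in> cbox s s'" for r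
    proof -
      have r: "r \<in> {0..T}" using that \<open>0 \<le> s\<close> \<open>s' \<le> T\<close> by auto
      show ?thesis
        using order_trans[OF growth[OF r] mult_left_mono[of "1 + norm (y r)" "1 + radius x" "2 * C"]] bnd[OF r] C
        unfolding speed_def by linarith
    qed
    from has_integral_bound[OF speed_nonneg int[OF that, folded cbox_interval] this]
    show ?thesis using that by simp
  qed
  let ?y = "restrict y {0..T}"
  show thesis
  proof (rule that[of ?y])
    have "?y \<in> mspace (path_space T)"
      unfolding mem_path_space using y continuous_on_cong[of "{0..T}" "{0..T}" ?y y] by simp
    moreover have "((\<lambda>s. ?h s (?y s)) has_integral (?y b - ?y a)) {a..b}"
      if "0 \<le> a \<and> a \<le> b \<and> b \<le> T" for a b
    proof -
      have "((\<lambda>s. ?h s (?y s)) has_integral (y b - y a)) {a..b}"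
        by (rule has_integral_eq[OF _ int[of a b]]) (use that in auto)
      then show ?thesis using that by simp
    qed
    ultimately show "is_motion f g T t x (\<lambda>s. a (cell n s)) (\<lambda>s. b (cell n s)) ?y"
      using y t unfolding is_motion_def by simp
    show "norm (?y s) \<le> radius x" if "s \<in> {0..T}" for s using bnd that by simp
    show "norm (?y s - ?y s') \<le> speed x * \<bar>s - s'\<bar>" if "s \<in> {0..T}" "s' \<in> {0..T}" for s s'
      using lip[of s s'] lip[of s' s] that by (cases "s \<le> s'") (auto simp: norm_minus_commute)
  qed
qed

section \<open>Euler runs and their limits\<close>

definition euler_run :: "nat \<Rightarrow> nat \<Rightarrow> (nat \<Rightarrow> real^'n) \<Rightarrow> (nat \<Rightarrow> 'p) \<Rightarrow> (nat \<Rightarrow> 'q) \<Rightarrow> bool" where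
  "euler_run n k z u v \<longleftrightarrow> (\<forall>i. u i \<in> P) \<and> (\<forall>i. v i \<in> Q) \<and>
     (\<forall>i\<ge>k. z (Suc i) = euler_move n i (z i) (u i) (v i))"

lemma uniform_modulus:
  fixes F :: "real \<Rightarrow> real^'n \<Rightarrow> 'c::metric_space \<Rightarrow> real^'n"
  assumes F: "continuous_on ({0..T} \<times> UNIV \<times> A) (\<lambda>(t, x, u). F t x u)"
    and "compact A" "\<eta> > 0"
  obtains d where "d > 0"
    "\<And>s x u s' x' u'. \<lbrakk>s \<in> {0..T}; s' \<in> {0..T}; norm x \<le> R; norm x' \<le> R; u \<in> A; u' \<in> A;
       dist s s' < d / 3; dist x x' < d / 3; dist u u' < d / 3\<rbrakk> \<Longrightarrow> norm (F s x u - F s' x' u') < \<eta>"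
proof -
  let ?K = "{0..T} \<times> cball 0 R \<times> A"
  have "uniformly_continuous_on ?K (\<lambda>(t, x, u). F t x u)"
    by (intro compact_uniformly_continuous continuous_on_subset[OF F] compact_Times assms) auto
  then obtain d where "d > 0" and d: "\<And>p p'. \<lbrakk>p \<in> ?K; p' \<in> ?K; dist p' p < d\<rbrakk> \<Longrightarrow>
      dist ((\<lambda>(t, x, u). F t x u) p') ((\<lambda>(t, x, u). F t x u) p) < \<eta>"
    using \<open>\<eta> > 0\<close> unfolding uniformly_continuous_on_def by meson
  have "norm (F s x u - F s' x' u') < \<eta>"
    if "s \<in> {0..T}" "s' \<in> {0..T}" "norm x \<le> R" "norm x' \<le> R" "u \<in> A" "u' \<in> A"
      "dist s s' < d / 3" "dist x x' < d / 3" "dist u u' < d / 3" for s x u s' x' u'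
    using d[of "(s', x', u')" "(s, x, u)"] dist_triple_less[OF that(7-9)] that(1-6)
    by (simp add: dist_norm)
  with \<open>d > 0\<close> show thesis by (rule that)
qed

text \<open>A motion from the limit point \<open>(t, x)\<close> is compared with an Euler run from a nearby node and a nearby
state, driven by nearby controls. Over one cell the velocities differ by the modulus of continuity
of \<open>f\<close> and \<open>g\<close> on a compact set that contains the motion, plus the Lipschitz term. So one threshold
\<open>d\<close> works for all controls.\<close>
lemma euler_tracks_motion:
  assumes t: "t \<in> {0..T}" and "e > 0"
  obtains d where "d > 0"
    "\<And>n k i a b u v y z. \<lbrakk>step n < d; \<bar>grid n k - t\<bar> < d; norm (z k - x) < d;
       \<And>i. a i \<in> P; \<And>i. b i \<in> Q; \<And>i. dist (a i) (u i) < d; \<And>i. dist (b i) (v i) < d;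
       euler_run n k z u v;
       is_motion f g T t x (\<lambda>s. a (cell n s)) (\<lambda>s. b (cell n s)) y;
       \<And>s. s \<in> {0..T} \<Longrightarrow> norm (y s) \<le> radius x;
       \<And>s s'. \<lbrakk>s \<in> {0..T}; s' \<in> {0..T}\<rbrakk> \<Longrightarrow> norm (y s - y s') \<le> speed x * \<bar>s - s'\<bar>;
       k \<le> i; i \<le> Suc n\<rbrakk> \<Longrightarrow> norm (y (grid n i) - z i) < e"
proof -
  define A where "A = exp (2 * L * T)"
  have A: "A \<ge> 1" using L T by (simp add: A_def)
  define B where "B = speed x"
  have B: "B \<ge> 0" by (simp add: B_def speed_nonneg)
  \<comment> \<open>The accumulated error is \<open>A * (initial error + T * 2\<eta>)\<close>; each of the two terms gets one half of \<open>e\<close>.\<close>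
  define \<eta> where "\<eta> = e / (4 * A * (T + 1))"
  have \<eta>: "\<eta> > 0" using A T \<open>e > 0\<close> by (simp add: \<eta>_def)
  have A\<eta>: "A * (T * (2 * \<eta>)) < e / 2"
  proof -
    have "A * (T * (2 * \<eta>)) = (e / 2) * (T / (T + 1))"
      using A T unfolding \<eta>_def by (simp add: divide_simps)
    also have "\<dots> < (e / 2) * 1"
      using T \<open>e > 0\<close> by (intro mult_strict_left_mono) auto
    finally show ?thesis by simp
  qed
  obtain d1 where "d1 > 0" and d1: "\<And>s x' u s' x'' u'. \<lbrakk>s \<in> {0..T}; s' \<in> {0..T};
      norm x' \<le> radius x; norm x'' \<le> radius x; u \<in> P; u' \<in> P; dist s s' < d1 / 3;
      dist x' x'' < d1 / 3; dist u u' < d1 / 3\<rbrakk> \<Longrightarrow> norm (f s x' u - f s' x'' u') < \<eta>"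
    using uniform_modulus[OF cont_f compact(1) \<eta>] by metis
  obtain d2 where "d2 > 0" and d2: "\<And>s x' u s' x'' u'. \<lbrakk>s \<in> {0..T}; s' \<in> {0..T};
      norm x' \<le> radius x; norm x'' \<le> radius x; u \<in> Q; u' \<in> Q; dist s s' < d2 / 3;
      dist x' x'' < d2 / 3; dist u u' < d2 / 3\<rbrakk> \<Longrightarrow> norm (g s x' u - g s' x'' u') < \<eta>"
    using uniform_modulus[OF cont_g compact(2) \<eta>] by metis
  define d0 where "d0 = min d1 d2 / 3"
  have d0: "d0 > 0" "d0 \<le> d1 / 3" "d0 \<le> d2 / 3" using \<open>d1 > 0\<close> \<open>d2 > 0\<close> by (auto simp: d0_def)
  \<comment> \<open>Within a cell the motion travels at most \<open>B * d\<close>; the initial error is at most \<open>(B + 1) * d\<close>.\<close>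
  define d where "d = min (d0 / (B + 1)) (e / (2 * A * (B + 1)))"
  have "d > 0" using d0 A B \<open>e > 0\<close> by (simp add: d_def)
  have dB: "(B + 1) * d \<le> d0" "A * ((B + 1) * d) \<le> e / 2"
  proof -
    have "d \<le> d0 / (B + 1)" "d \<le> e / (2 * A * (B + 1))" by (auto simp: d_def)
    moreover have "B + 1 > 0" "2 * A * (B + 1) > 0" using A B by auto
    ultimately have "d * (B + 1) \<le> d0" "d * (2 * A * (B + 1)) \<le> e"
      by (simp_all only: pos_le_divide_eq)
    then show "(B + 1) * d \<le> d0" "A * ((B + 1) * d) \<le> e / 2"
      by (simp_all only: mult_ac)
  qed
  have dd0: "d \<le> d0" "B * d < d0"
    using dB(1) B \<open>d > 0\<close> mult_nonneg_nonneg[of B d] unfolding distrib_right by linarith+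
  show thesis
  proof (rule that[OF \<open>d > 0\<close>])
    fix n k i a b u v y z
    assume h: "step n < d" and tk: "\<bar>grid n k - t\<bar> < d" and zk: "norm (z k - x) < d"
      and a: "\<And>i. a i \<in> P" and b: "\<And>i. b i \<in> Q"
      and au: "\<And>i. dist (a i) (u i) < d" and bv: "\<And>i. dist (b i) (v i) < d"
      and run: "euler_run n k z u v"
      and mot: "is_motion f g T t x (\<lambda>s. a (cell n s)) (\<lambda>s. b (cell n s)) y"
      and bnd: "\<And>s. s \<in> {0..T} \<Longrightarrow> norm (y s) \<le> radius x"
      and lip: "\<And>s s'. \<lbrakk>s \<in> {0..T}; s' \<in> {0..T}\<rbrakk> \<Longrightarrow> norm (y s - y s') \<le> speed x * \<bar>s - s'\<bar>"
      and i: "k \<le> i" "i \<le> Suc n"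
    have uP: "u j \<in> P" and vQ: "v j \<in> Q" for j using run by (auto simp: euler_run_def)
    have gk: "grid n k \<in> {0..T}" using i by (intro grid_in) simp
    let ?F = "\<lambda>s. f s (y s) (a (cell n s)) + g s (y s) (b (cell n s))"
    let ?G = "\<lambda>j. f (grid n j) (z j) (u j) + g (grid n j) (z j) (v j)"
    have "norm (y (real i * step n) - z i) \<le> (1 + 2 * L * step n) ^ (i - k) *
        (norm (y (real k * step n) - z k) + real (i - k) * step n * (2 * \<eta>))"
    proof (rule euler_error[where n="Suc n" and F="?F" and G="?G"])
      show "(?F has_integral y (real (Suc j) * step n) - y (real j * step n))
          {real j * step n..real (Suc j) * step n}" if "k \<le> j" "j < Suc n" for j
      proof -
        have "grid n j \<in> {0..T}" "grid n (Suc j) \<in> {0..T}" "grid n j \<le> grid n (Suc j)"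
          using that by (auto intro!: grid_in grid_mono simp del: atLeastAtMost_iff)
        then show ?thesis
          using mot unfolding is_motion_def grid_def by simp
      qed
      show "z (Suc j) = z j + step n *\<^sub>R ?G j" if "k \<le> j" for j
        using run that by (auto simp: euler_run_def euler_move_def)
      show "norm (?F s - ?G j) \<le> 2 * \<eta> + 2 * L * norm (y (real j * step n) - z j)"
        if "k \<le> j" "j < Suc n" and s: "real j * step n \<le> s" "s < real (Suc j) * step n" for j s
      proof -
        have c: "cell n s = j" using s by (intro cell_eq) (auto simp: grid_def)
        have gj: "grid n j \<in> {0..T}" "grid n (Suc j) \<in> {0..T}" using that by (auto intro!: grid_in simp del: atLeastAtMost_iff)
        have sT: "s \<in> {0..T}" using gj s by (auto simp: grid_def)
        have ds: "\<bar>s - grid n j\<bar> < d" using s h by (auto simp: grid_def algebra_simps)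
        then have "B * \<bar>s - grid n j\<bar> \<le> B * d" using B by (intro mult_left_mono) auto
        with lip[OF sT gj(1)] have dy: "dist (y s) (y (grid n j)) < d0"
          using dd0 by (simp add: dist_norm B_def)
        have "norm (f s (y s) (a j) - f (grid n j) (y (grid n j)) (u j)) < \<eta>"
          using ds dy d0 dd0 au[of j]
          by (intro d1 sT gj bnd a uP) (auto simp: dist_real_def)
        moreover have "norm (g s (y s) (b j) - g (grid n j) (y (grid n j)) (v j)) < \<eta>"
          using ds dy d0 dd0 bv[of j]
          by (intro d2 sT gj bnd b vQ) (auto simp: dist_real_def)
        moreover note lip_f[OF gj(1) uP[of j], of "y (grid n j)" "z j"]
          lip_g[OF gj(1) vQ[of j], of "y (grid n j)" "z j"]
        moreover have "?F s - ?G j =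
           (f s (y s) (a j) - f (grid n j) (y (grid n j)) (u j)) +
           (g s (y s) (b j) - g (grid n j) (y (grid n j)) (v j)) +
           (f (grid n j) (y (grid n j)) (u j) - f (grid n j) (z j) (u j)) +
           (g (grid n j) (y (grid n j)) (v j) - g (grid n j) (z j) (v j))"
          by (simp add: c)
        then have "norm (?F s - ?G j) \<le>
           norm (f s (y s) (a j) - f (grid n j) (y (grid n j)) (u j)) +
           norm (g s (y s) (b j) - g (grid n j) (y (grid n j)) (v j)) +
           norm (f (grid n j) (y (grid n j)) (u j) - f (grid n j) (z j) (u j)) +
           norm (g (grid n j) (y (grid n j)) (v j) - g (grid n j) (z j) (v j))"
          by (simp only:) (intro norm_triangle_mono order_refl)
        ultimately show ?thesis by (simp add: grid_def)
      qed
    qed (use step_nonneg L \<eta> i in auto)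
    also have "\<dots> \<le> A * ((B + 1) * d + T * (2 * \<eta>))"
    proof (intro mult_mono add_mono)
      have "(1 + 2 * L * step n) ^ (i - k) \<le> exp (2 * L * step n) ^ (i - k)"
        using L step_nonneg[of n] by (intro power_mono) auto
      also have "\<dots> = exp (2 * L * (real (i - k) * step n))"
        by (simp add: exp_of_nat_mult[symmetric] mult_ac)
      also have "real (i - k) * step n \<le> T"
        using grid_mono[of "i - k" "Suc n" n] i grid_last[of n] by (simp add: grid_def)
      then have "exp (2 * L * (real (i - k) * step n)) \<le> A"
        using L by (simp add: A_def mult_left_mono)
      finally show "(1 + 2 * L * step n) ^ (i - k) \<le> A" .
      have "norm (y (grid n k) - y t) \<le> B * d"
        using lip[OF gk t] tk B mult_left_mono[of "\<bar>grid n k - t\<bar>" d B] by (simp add: B_def)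
      moreover have "y t = x" using mot by (simp add: is_motion_def)
      moreover have "norm (y (grid n k) - z k) \<le> norm (y (grid n k) - x) + norm (x - z k)"
        using norm_triangle_ineq[of "y (grid n k) - x" "x - z k"] by simp
      ultimately show "norm (y (real k * step n) - z k) \<le> (B + 1) * d"
        using zk by (simp add: grid_def norm_minus_commute algebra_simps)
      show "real (i - k) * step n \<le> T"
        using grid_mono[of "i - k" "Suc n" n] i grid_last[of n] by (simp add: grid_def)
    qed (use A \<eta> L T step_nonneg in auto)
    also have "\<dots> = A * ((B + 1) * d) + A * (T * (2 * \<eta>))" by (simp add: distrib_left)
    also have "\<dots> < e" using dB(2) A\<eta> by simp
    finally show "norm (y (grid n i) - z i) < e" by (simp add: grid_def)
  qed
qed

text \<open>Euler runs from points that converge to \<open>(t, x)\<close> shadow genuine motions from \<open>(t, x)\<close>, and a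
subsequence of these converges uniformly by Arzela and Ascoli. Its limit need not be a motion,
only a point of the closure of the motions. One subsequence serves all choices of nodes \<open>m\<close>.\<close>
lemma euler_runs_accumulate:
  assumes t: "t \<in> {0..T}" and n: "filterlim n at_top sequentially"
    and k: "\<And>j. k j \<le> Suc (n j)" and tk: "(\<lambda>j. grid (n j) (k j)) \<longlonglongrightarrow> t"
    and zk: "(\<lambda>j. z j (k j)) \<longlonglongrightarrow> x" and run: "\<And>j. euler_run (n j) (k j) (z j) (u j) (v j)"
    and a: "\<And>j i. a j i \<in> P" and b: "\<And>j i. b j i \<in> Q"
    and au: "\<And>j i. dist (a j i) (u j i) < \<epsilon> j" and bv: "\<And>j i. dist (b j i) (v j i) < \<epsilon> j"
    and \<epsilon>: "\<epsilon> \<longlonglongrightarrow> 0"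
  obtains y r where "strict_mono r" "y t = x"
    "y \<in> mtopology_of (path_space T) closure_of
       {y. \<exists>j. is_motion f g T t x (\<lambda>s. a j (cell (n j) s)) (\<lambda>s. b j (cell (n j) s)) y}"
    "\<And>m t'. \<lbrakk>t' \<in> {0..T}; \<And>j. k j \<le> m j \<and> m j \<le> Suc (n j); (\<lambda>j. grid (n j) (m j)) \<longlonglongrightarrow> t'\<rbrakk>
       \<Longrightarrow> (\<lambda>j. z (r j) (m (r j))) \<longlonglongrightarrow> y t'"
proof -
  let ?motion = "\<lambda>j. is_motion f g T t x (\<lambda>s. a j (cell (n j) s)) (\<lambda>s. b j (cell (n j) s))"
  have "\<exists>y. ?motion j y \<and> (\<forall>s\<in>{0..T}. norm (y s) \<le> radius x) \<and>
      (\<forall>s\<in>{0..T}. \<forall>s'\<in>{0..T}. norm (y s - y s') \<le> speed x * \<bar>s - s'\<bar>)" for j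
    by (rule motion_exists[OF t, of "a j" "b j" "x" "n j"]) (use a b in auto)
  then obtain Y where Y: "\<And>j. ?motion j (Y j)"
    and bnd: "\<And>j s. s \<in> {0..T} \<Longrightarrow> norm (Y j s) \<le> radius x"
    and lip: "\<And>j s s'. \<lbrakk>s \<in> {0..T}; s' \<in> {0..T}\<rbrakk> \<Longrightarrow> norm (Y j s - Y j s') \<le> speed x * \<bar>s - s'\<bar>"
    by metis
  obtain w r where w: "continuous_on {0..T} w" and r: "strict_mono (r :: nat \<Rightarrow> nat)"
    and unif: "\<And>e. 0 < e \<Longrightarrow> \<exists>N. \<forall>j s. j \<ge> N \<and> s \<in> {0..T} \<longrightarrow> norm (Y (r j) s - w s) < e"
  proof (rule Arzela_Ascoli[of "{0..T}" Y "radius x"])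
    show "\<exists>d>0. \<forall>n s'. s' \<in> {0..T} \<and> norm (s - s') < d \<longrightarrow> norm (Y n s - Y n s') < e"
      if "s \<in> {0..T}" "0 < e" for s e
    proof (intro exI[of _ "e / (speed x + 1)"] conjI allI impI)
      show "0 < e / (speed x + 1)" using that speed_nonneg[of x] by simp
      fix j s' assume s': "s' \<in> {0..T} \<and> norm (s - s') < e / (speed x + 1)"
      have "norm (Y j s - Y j s') \<le> speed x * \<bar>s - s'\<bar>" using lip that s' by blast
      also have "\<dots> \<le> speed x * (e / (speed x + 1))"
        using s' speed_nonneg[of x] by (intro mult_left_mono) auto
      also have "\<dots> < e" using that speed_nonneg[of x] by (simp add: field_simps)
      finally show "norm (Y j s - Y j s') < e" .
    qed
  qed (use bnd in auto)
  define y where "y = restrict w {0..T}"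
  have unif: "\<exists>N. \<forall>j\<ge>N. \<forall>s\<in>{0..T}. norm (Y (r j) s - y s) < e" if "e > 0" for e
    using unif[OF that] by (fastforce simp: y_def)
  have ptw: "(\<lambda>j. Y (r j) s) \<longlonglongrightarrow> y s" if "s \<in> {0..T}" for s
    unfolding LIMSEQ_iff using unif that by blast
  show thesis
  proof (rule that[OF r])
    have "Y (r j) t = x" for j using Y[of "r j"] by (simp add: is_motion_def)
    then show "y t = x" using ptw[OF t] by (simp add: LIMSEQ_const_iff)
    show "y \<in> mtopology_of (path_space T) closure_of {y. \<exists>j. ?motion j y}"
    proof (rule uniform_approx_in_closure[OF T])
      show "y \<in> mspace (path_space T)"
        unfolding mem_path_space y_def using w continuous_on_cong[of "{0..T}" "{0..T}" "restrict w {0..T}" w]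
        by simp
      show "{y. \<exists>j. ?motion j y} \<subseteq> mspace (path_space T)"
        unfolding is_motion_def by blast
      show "\<exists>w\<in>{y. \<exists>j. ?motion j y}. \<forall>s\<in>{0..T}. norm (w s - y s) < e" if "e > 0" for e
        using unif[OF that] Y by blast
    qed
    have track: "\<forall>\<^sub>F j in sequentially. \<forall>i. k j \<le> i \<and> i \<le> Suc (n j) \<longrightarrow> norm (Y j (grid (n j) i) - z j i) < e"
      if "e > 0" for e
    proof -
      obtain d where "d > 0" and d: "\<And>n k i a b u v y z. \<lbrakk>step n < d; \<bar>grid n k - t\<bar> < d;
         norm (z k - x) < d; \<And>i. a i \<in> P; \<And>i. b i \<in> Q; \<And>i. dist (a i) (u i) < d;
         \<And>i. dist (b i) (v i) < d; euler_run n k z u v;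
         is_motion f g T t x (\<lambda>s. a (cell n s)) (\<lambda>s. b (cell n s)) y;
         \<And>s. s \<in> {0..T} \<Longrightarrow> norm (y s) \<le> radius x;
         \<And>s s'. \<lbrakk>s \<in> {0..T}; s' \<in> {0..T}\<rbrakk> \<Longrightarrow> norm (y s - y s') \<le> speed x * \<bar>s - s'\<bar>;
         k \<le> i; i \<le> Suc n\<rbrakk> \<Longrightarrow> norm (y (grid n i) - z i) < e"
        using euler_tracks_motion[OF t \<open>e > 0\<close>, of x] by blast
      have "\<forall>\<^sub>F j in sequentially. step (n j) < d"
        by (rule order_tendstoD(2)[OF step_tendsto_0[OF n] \<open>d > 0\<close>])
      moreover have "\<forall>\<^sub>F j in sequentially. \<epsilon> j < d"
        by (rule order_tendstoD(2)[OF \<epsilon> \<open>d > 0\<close>])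
      moreover have "\<forall>\<^sub>F j in sequentially. dist (grid (n j) (k j)) t < d"
        by (rule tendstoD[OF tk \<open>d > 0\<close>])
      moreover have "\<forall>\<^sub>F j in sequentially. dist (z j (k j)) x < d"
        by (rule tendstoD[OF zk \<open>d > 0\<close>])
      ultimately show ?thesis
      proof eventually_elim
        case (elim j)
        have "dist (a j i) (u j i) < d" "dist (b j i) (v j i) < d" for i
          using au[of j i] bv[of j i] elim by linarith+
        then show ?case
          using elim by (intro allI impI d[of "n j" "k j" "z j" "a j" "b j" "u j" "v j" "Y j"])
            (use a b run Y bnd lip in \<open>auto simp: dist_norm dist_real_def simp del: atLeastAtMost_iff\<close>)
      qed
    qed
    show "(\<lambda>j. z (r j) (m (r j))) \<longlonglongrightarrow> y t'"
      if t': "t' \<in> {0..T}" and m: "\<And>j. k j \<le> m j \<and> m j \<le> Suc (n j)"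
        and grid: "(\<lambda>j. grid (n j) (m j)) \<longlonglongrightarrow> t'" for m t'
    proof -
      have "(\<lambda>j. z j (m j) - Y j (grid (n j) (m j))) \<longlonglongrightarrow> 0"
      proof (rule tendstoI)
        fix e :: real assume "e > 0"
        from track[OF this] show "\<forall>\<^sub>F j in sequentially. dist (z j (m j) - Y j (grid (n j) (m j))) 0 < e"
          by eventually_elim (use m in \<open>auto simp: norm_minus_commute\<close>)
      qed
      from LIMSEQ_subseq_LIMSEQ[OF this r]
      have 1: "(\<lambda>j. z (r j) (m (r j)) - Y (r j) (grid (n (r j)) (m (r j)))) \<longlonglongrightarrow> 0" by (simp add: o_def)
      have "(\<lambda>j. Y j (grid (n j) (m j)) - Y j t') \<longlonglongrightarrow> 0"
      proof (rule Lim_null_comparison)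
        show "\<forall>\<^sub>F j in sequentially. norm (Y j (grid (n j) (m j)) - Y j t') \<le> speed x * \<bar>grid (n j) (m j) - t'\<bar>"
          by (intro always_eventually allI lip grid_in t') (use m in auto)
        have "(\<lambda>j. speed x * \<bar>grid (n j) (m j) - t'\<bar>) \<longlonglongrightarrow> speed x * \<bar>t' - t'\<bar>"
          by (intro tendsto_intros grid)
        then show "(\<lambda>j. speed x * \<bar>grid (n j) (m j) - t'\<bar>) \<longlonglongrightarrow> 0" by simp
      qed
      from LIMSEQ_subseq_LIMSEQ[OF this r]
      have 2: "(\<lambda>j. Y (r j) (grid (n (r j)) (m (r j))) - Y (r j) t') \<longlonglongrightarrow> 0" by (simp add: o_def)
      from tendsto_add[OF tendsto_add[OF 1 2] ptw[OF t']] show ?thesis by simp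
    qed
  qed
qed

end

section \<open>The limit of the discrete values\<close>

text \<open>A value of the discrete game is a selection \<open>W\<close> of equilibrium payoffs: it is attained by some move,
and each player who deviates can be prevented from gaining. The assumptions are discrete
counterparts of the four conditions on \<open>S\<close>, for one step and with controls from finite nets.\<close>
locale discrete_values = controlled_system T P Q f g L C
  for T :: real
    and P :: "'p::metric_space set" and Q :: "'q::metric_space set"
    and f :: "real \<Rightarrow> real^'n \<Rightarrow> 'p \<Rightarrow> real^'n"
    and g :: "real \<Rightarrow> real^'n \<Rightarrow> 'q \<Rightarrow> real^'n"
    and L C :: real +
  fixes \<sigma> :: "real^'n \<Rightarrow> real \<times> real"
    and PN :: "nat \<Rightarrow> 'p set" and QN :: "nat \<Rightarrow> 'q set"
    and W :: "nat \<Rightarrow> nat \<Rightarrow> real^'n \<Rightarrow> real \<times> real"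
  assumes cont_\<sigma>: "continuous_on UNIV \<sigma>"
    and nets: "PN n \<subseteq> P" "QN n \<subseteq> Q"
    and dense_P: "u \<in> P \<Longrightarrow> \<exists>u'\<in>PN n. dist u u' < inverse (real (Suc n))"
    and dense_Q: "v \<in> Q \<Longrightarrow> \<exists>v'\<in>QN n. dist v v' < inverse (real (Suc n))"
    and W_final: "W n (Suc n) = \<sigma>"
    and W_attained: "k \<le> n \<Longrightarrow> \<exists>u\<in>PN n. \<exists>v\<in>QN n. W n (Suc k) (euler_move n k x u v) = W n k x"
    and W_punish1: "\<lbrakk>k \<le> n; u \<in> PN n\<rbrakk> \<Longrightarrow>
      \<exists>v\<in>QN n. fst (W n (Suc k) (euler_move n k x u v)) \<le> fst (W n k x)"
    and W_punish2: "\<lbrakk>k \<le> n; v \<in> QN n\<rbrakk> \<Longrightarrow>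
      \<exists>u\<in>PN n. snd (W n (Suc k) (euler_move n k x u v)) \<le> snd (W n k x)"
begin

definition value_graph :: "nat \<Rightarrow> (real \<times> (real^'n) \<times> (real \<times> real)) set" where
  "value_graph n = {(grid n k, x, W n k x) | k x. k \<le> Suc n}"

text \<open>The graph of \<open>S\<close> is the upper Kuratowski limit of the graphs of the discrete values: \<open>J \<in> S t x\<close> iff
\<open>(t, x, J)\<close> is approached by points of these graphs with arbitrarily large \<open>n\<close>.\<close>
definition S :: "real \<Rightarrow> real^'n \<Rightarrow> (real \<times> real) set" where
  "S t x = {J. (t, x, J) \<in> (\<Inter>m. closure (\<Union>n\<in>{m..}. value_graph n))}"

lemma S_upper_semicontinuous: "upper_semicontinuous_mv T S"
  unfolding upper_semicontinuous_mv_def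
proof (intro allI impI, elim conjE)
  fix tl xl Jl t x J
  assume *: "\<forall>l::nat. tl l \<in> {0..T} \<and> Jl l \<in> S (tl l) (xl l)"
    "tl \<longlonglongrightarrow> t" "xl \<longlonglongrightarrow> x" "Jl \<longlonglongrightarrow> J"
  have "(t, x, J) \<in> (\<Inter>m. closure (\<Union>n\<in>{m..}. value_graph n))"
  proof (rule Lim_in_closed_set)
    show "(\<lambda>l. (tl l, xl l, Jl l)) \<longlonglongrightarrow> (t, x, J)" by (intro tendsto_Pair *)
  qed (use * in \<open>auto simp: S_def\<close>)
  then show "J \<in> S t x" by (simp add: S_def)
qed

lemma S_I:
  assumes n: "filterlim n at_top sequentially" and k: "\<And>j. k j \<le> Suc (n j)"
    and "(\<lambda>j. grid (n j) (k j)) \<longlonglongrightarrow> t" "xs \<longlonglongrightarrow> x" "(\<lambda>j. W (n j) (k j) (xs j)) \<longlonglongrightarrow> J"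
  shows "J \<in> S t x"
proof -
  have "(t, x, J) \<in> closure (\<Union>n\<in>{m..}. value_graph n)" for m
  proof (rule Lim_in_closed_set[OF closed_closure])
    show "(\<lambda>j. (grid (n j) (k j), xs j, W (n j) (k j) (xs j))) \<longlonglongrightarrow> (t, x, J)"
      by (intro tendsto_Pair assms)
    have "\<forall>\<^sub>F j in sequentially. n j \<ge> m" using n by (simp add: filterlim_at_top)
    then show "\<forall>\<^sub>F j in sequentially.
        (grid (n j) (k j), xs j, W (n j) (k j) (xs j)) \<in> closure (\<Union>n\<in>{m..}. value_graph n)"
      by eventually_elim
        (rule subsetD[OF closure_subset], use k in \<open>auto simp: value_graph_def\<close>)
  qed simp
  then show ?thesis by (simp add: S_def)
qed

lemma S_E:
  assumes "J \<in> S t x"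
  obtains n k xs where "filterlim n at_top sequentially" "\<And>j. k j \<le> Suc (n j)"
    "(\<lambda>j. grid (n j) (k j)) \<longlonglongrightarrow> t" "xs \<longlonglongrightarrow> x" "(\<lambda>j. W (n j) (k j) (xs j)) \<longlonglongrightarrow> J"
proof -
  have "\<exists>n\<ge>j. \<exists>k\<le>Suc n. \<exists>y. dist (grid n k, y, W n k y) (t, x, J) < inverse (real (Suc j))" for j
  proof -
    have "(t, x, J) \<in> closure (\<Union>n\<in>{j..}. value_graph n)" using assms by (simp add: S_def)
    then obtain p where "p \<in> (\<Union>n\<in>{j..}. value_graph n)" "dist p (t, x, J) < inverse (real (Suc j))"
      unfolding closure_approachable by (metis inverse_positive_iff_positive of_nat_0_less_iff zero_less_Suc)
    then show ?thesis by (auto simp: value_graph_def)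
  qed
  then obtain n k xs where nk: "\<And>j. n j \<ge> j" "\<And>j. k j \<le> Suc (n j)"
    and d: "\<And>j. dist (grid (n j) (k j), xs j, W (n j) (k j) (xs j)) (t, x, J) < inverse (real (Suc j))"
    by metis
  have lim: "(\<lambda>j. (grid (n j) (k j), xs j, W (n j) (k j) (xs j))) \<longlonglongrightarrow> (t, x, J)"
  proof (rule metric_tendsto_imp_tendsto[OF LIMSEQ_inverse_real_of_nat])
    show "\<forall>\<^sub>F j in sequentially. dist (grid (n j) (k j), xs j, W (n j) (k j) (xs j)) (t, x, J)
      \<le> dist (inverse (real (Suc j))) 0"
      using d by (intro always_eventually) (auto simp: less_imp_le)
  qed
  have "filterlim n at_top sequentially"
    unfolding filterlim_at_top eventually_sequentially using nk(1) order_trans by blast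
  from that[OF this nk(2)] tendsto_fst[OF lim] tendsto_fst[OF tendsto_snd[OF lim]]
    tendsto_snd[OF tendsto_snd[OF lim]]
  show thesis by simp
qed

text \<open>Transitivity of \<open>\<rho>\<close> passes a relation between the values at consecutive nodes to all later nodes.\<close>
lemma follow_values:
  assumes good: "\<And>i y. i \<le> n \<Longrightarrow> \<exists>u\<in>A. \<exists>v\<in>B. \<rho> (W n (Suc i) (euler_move n i y u v)) (W n i y)"
    and sub: "A \<subseteq> P" "B \<subseteq> Q" and \<rho>: "reflp \<rho>" "transp \<rho>"
  obtains z u v where "z k = x" "euler_run n k z u v" "\<And>i. u i \<in> A" "\<And>i. v i \<in> B"
    "\<And>i. \<lbrakk>k \<le> i; i \<le> Suc n\<rbrakk> \<Longrightarrow> \<rho> (W n i (z i)) (W n k x)"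
proof -
  have "\<exists>u\<in>A. \<exists>v\<in>B. i \<le> n \<longrightarrow> \<rho> (W n (Suc i) (euler_move n i y u v)) (W n i y)" for i y
    using good[of i y] good[of 0 y] by blast
  from follow_feedback[of A B "\<lambda>i y u v. i \<le> n \<longrightarrow> \<rho> (W n (Suc i) (euler_move n i y u v)) (W n i y)", OF this]
  obtain z u v where z: "z k = x" "\<And>i. u i \<in> A" "\<And>i. v i \<in> B"
    "\<And>i. k \<le> i \<Longrightarrow> z (Suc i) = euler_move n i (z i) (u i) (v i)"
    "\<And>i. i \<le> n \<longrightarrow> \<rho> (W n (Suc i) (euler_move n i (z i) (u i) (v i))) (W n i (z i))"
    by (metis (no_types, lifting))
  have "\<rho> (W n i (z i)) (W n k x)" if "k \<le> i" "i \<le> Suc n" for i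
    using that
  proof (induction i rule: dec_induct)
    case base
    then show ?case using z(1) reflpD[OF \<rho>(1)] by simp
  next
    case (step i)
    then have "\<rho> (W n (Suc i) (z (Suc i))) (W n i (z i))" using z(4)[of i] z(5)[of i] by simp
    with step show ?case using transpD[OF \<rho>(2)] by simp
  qed
  moreover have "euler_run n k z u v"
    using z sub unfolding euler_run_def by blast
  ultimately show thesis using that z by blast
qed

text \<open>Compactness of the values comes for free: following the moves that attain \<open>W\<close>, every value is the
terminal payoff of an Euler run, and the end points of these runs accumulate at a finite state.\<close>
lemma values_accumulate:
  assumes t: "t \<in> {0..T}" and n: "filterlim n at_top sequentially" and k: "\<And>j. k j \<le> Suc (n j)"
    and tk: "(\<lambda>j. grid (n j) (k j)) \<longlonglongrightarrow> t" and xs: "xs \<longlonglongrightarrow> x"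
  obtains r y where "strict_mono r" "y t = x" "(\<lambda>j. W (n (r j)) (k (r j)) (xs (r j))) \<longlonglongrightarrow> \<sigma> (y T)"
proof -
  have "\<exists>z u v. z (k j) = xs j \<and> euler_run (n j) (k j) z u v \<and>
      W (n j) (Suc (n j)) (z (Suc (n j))) = W (n j) (k j) (xs j)" for j
  proof (rule follow_values[OF W_attained nets, of "n j" "k j" "xs j"])
    fix z u v
    assume "z (k j) = xs j" "euler_run (n j) (k j) z u v"
      and "\<And>i. \<lbrakk>k j \<le> i; i \<le> Suc (n j)\<rbrakk> \<Longrightarrow> W (n j) i (z i) = W (n j) (k j) (xs j)"
    then show ?thesis using k[of j] by blast
  qed (auto simp: reflp_def transp_def)
  then obtain z u v where z: "\<And>j. z j (k j) = xs j" and run: "\<And>j. euler_run (n j) (k j) (z j) (u j) (v j)"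
    and W: "\<And>j. \<sigma> (z j (Suc (n j))) = W (n j) (k j) (xs j)"
    unfolding W_final by metis
  have "(\<lambda>j. z j (k j)) \<longlonglongrightarrow> x" using xs z by simp
  moreover have "u j i \<in> P" "v j i \<in> Q" for j i using run by (auto simp: euler_run_def)
  moreover have "dist (u j i) (u j i) < inverse (real (Suc j))"
    "dist (v j i) (v j i) < inverse (real (Suc j))" for j i by auto
  ultimately
  obtain y r where r: "strict_mono r" "y t = x"
    and lim: "\<And>m t'. \<lbrakk>t' \<in> {0..T}; \<And>j. k j \<le> m j \<and> m j \<le> Suc (n j); (\<lambda>j. grid (n j) (m j)) \<longlonglongrightarrow> t'\<rbrakk>
       \<Longrightarrow> (\<lambda>j. z (r j) (m (r j))) \<longlonglongrightarrow> y t'"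
    by (rule euler_runs_accumulate[OF t n k tk _ run _ _ _ _ LIMSEQ_inverse_real_of_nat, of x u v]) blast
  have "(\<lambda>j. z (r j) (Suc (n (r j)))) \<longlonglongrightarrow> y T"
    by (rule lim) (use T k in \<open>auto simp: grid_last\<close>)
  then have "(\<lambda>j. \<sigma> (z (r j) (Suc (n (r j))))) \<longlonglongrightarrow> \<sigma> (y T)"
    by (rule continuous_on_tendsto_compose[OF cont_\<sigma>]) auto
  with that r W show thesis by simp
qed

lemma S_nonempty: assumes t: "t \<in> {0..T}" shows "S t x \<noteq> {}"
proof -
  have "\<exists>k. k \<le> Suc n \<and> \<bar>grid n k - t\<bar> \<le> step n" for n
  proof -
    obtain k where "k \<le> Suc n" "\<bar>grid n k - t\<bar> \<le> \<bar>grid n 0 - 0\<bar> + step n"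
      by (rule grid_point_near[OF t, of 0 n 0]) (use t in auto)
    then show ?thesis by (auto simp: grid_def)
  qed
  then obtain k where k: "\<And>n. k n \<le> Suc n" "\<And>n. \<bar>grid n (k n) - t\<bar> \<le> step n" by metis
  have "(\<lambda>n. grid n (k n) - t) \<longlonglongrightarrow> 0"
    by (rule Lim_null_comparison[OF _ step_tendsto_0[OF filterlim_ident]]) (use k in auto)
  then have tk: "(\<lambda>n. grid n (k n)) \<longlonglongrightarrow> t" by (simp add: LIM_zero_iff)
  obtain r y where r: "strict_mono r" and "y t = x" and W: "(\<lambda>j. W (r j) (k (r j)) x) \<longlonglongrightarrow> \<sigma> (y T)"
    by (rule values_accumulate[OF t filterlim_ident k(1) tk tendsto_const[of x]]) (rule that)
  have "\<sigma> (y T) \<in> S t x"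
    by (rule S_I[OF filterlim_subseq[OF r] _ _ tendsto_const W])
      (use k LIMSEQ_subseq_LIMSEQ[OF tk r] in \<open>auto simp: o_def\<close>)
  then show ?thesis by blast
qed

text \<open>As \<open>t = T\<close> leaves no time to move, the end points of the Euler runs accumulate at \<open>x\<close> itself.\<close>
lemma S_final: "S T x = {\<sigma> x}"
proof -
  have T': "T \<in> {0..T}" using T by simp
  have "J = \<sigma> x" if J: "J \<in> S T x" for J
  proof -
    obtain n k xs where *: "filterlim n at_top sequentially" "\<And>j. k j \<le> Suc (n j)"
      "(\<lambda>j. grid (n j) (k j)) \<longlonglongrightarrow> T" "xs \<longlonglongrightarrow> x" and W: "(\<lambda>j. W (n j) (k j) (xs j)) \<longlonglongrightarrow> J"
      by (rule S_E[OF J]) (rule that)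
    obtain r y where r: "strict_mono r" "y T = x" and lim:
      "(\<lambda>j. W (n (r j)) (k (r j)) (xs (r j))) \<longlonglongrightarrow> \<sigma> (y T)"
      by (rule values_accumulate[OF T' *]) (rule that)
    from lim LIMSEQ_subseq_LIMSEQ[OF W r(1)] show ?thesis
      using LIMSEQ_unique r(2) by (auto simp: o_def)
  qed
  with S_nonempty[OF T', of x] show ?thesis by blast
qed

text \<open>The common limit argument behind all three stability conditions. The sets \<open>A n\<close> and \<open>B n\<close> are the
controls used in the discrete game, \<open>U\<close> and \<open>V\<close> the controls that they approximate, and \<open>\<rho>\<close> is the
relation between a later and an earlier payoff: an inequality for the player whose
control is fixed, and equality when neither control is. In the limit \<open>\<rho>\<close> survives because it is closed.

The subsequences are taken in two stages. The first makes the motions converge, hence also the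
Euler states at nodes near \<open>t'\<close>; the second makes the values at these states converge.\<close>
theorem S_stable:
  assumes t: "t \<in> {0..T}" and t': "t' \<in> {t..T}" and J: "J \<in> S t x"
    and good: "\<And>n i y. i \<le> n \<Longrightarrow>
      \<exists>u\<in>A n. \<exists>v\<in>B n. \<rho> (W n (Suc i) (euler_move n i y u v)) (W n i y)"
    and sub: "\<And>n. A n \<subseteq> P" "\<And>n. B n \<subseteq> Q" "U \<subseteq> P" "V \<subseteq> Q"
    and near_U: "\<And>n u. u \<in> A n \<Longrightarrow> \<exists>a\<in>U. dist a u < inverse (real (Suc n))"
    and near_V: "\<And>n v. v \<in> B n \<Longrightarrow> \<exists>b\<in>V. dist b v < inverse (real (Suc n))"
    and \<rho>: "reflp \<rho>" "transp \<rho>" "closed {(p, q). \<rho> p q}"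
  shows "\<exists>y\<in>mtopology_of (path_space T) closure_of
      {y. \<exists>n a b. range a \<subseteq> U \<and> range b \<subseteq> V \<and>
         is_motion f g T t x (\<lambda>s. a (cell n s)) (\<lambda>s. b (cell n s)) y}.
    \<exists>J'\<in>S t' (y t'). \<rho> J' J"
proof -
  obtain n k xs where n: "filterlim n at_top sequentially" and k: "\<And>j. k j \<le> Suc (n j)"
    and tk: "(\<lambda>j. grid (n j) (k j)) \<longlonglongrightarrow> t" and xs: "xs \<longlonglongrightarrow> x"
    and W: "(\<lambda>j. W (n j) (k j) (xs j)) \<longlonglongrightarrow> J"
    by (rule S_E[OF J]) (rule that)
  have "\<exists>z u v a b. z (k j) = xs j \<and> euler_run (n j) (k j) z u v \<and>
      (\<forall>i. a i \<in> U \<and> b i \<in> V \<and> dist (a i) (u i) < inverse (real (Suc (n j))) \<and>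
         dist (b i) (v i) < inverse (real (Suc (n j)))) \<and>
      (\<forall>i. k j \<le> i \<and> i \<le> Suc (n j) \<longrightarrow> \<rho> (W (n j) i (z i)) (W (n j) (k j) (xs j)))" for j
  proof -
    obtain z u v where z: "z (k j) = xs j" "euler_run (n j) (k j) z u v"
      and uv: "\<And>i. u i \<in> A (n j)" "\<And>i. v i \<in> B (n j)"
      and le: "\<And>i. \<lbrakk>k j \<le> i; i \<le> Suc (n j)\<rbrakk> \<Longrightarrow> \<rho> (W (n j) i (z i)) (W (n j) (k j) (xs j))"
      by (rule follow_values[OF good sub(1,2) \<rho>(1,2), of "n j" "k j" "xs j"]) (assumption, rule that)
    obtain a where a: "\<And>i. a i \<in> U \<and> dist (a i) (u i) < inverse (real (Suc (n j)))"
      using near_U[OF uv(1)] by metis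
    obtain b where b: "\<And>i. b i \<in> V \<and> dist (b i) (v i) < inverse (real (Suc (n j)))"
      using near_V[OF uv(2)] by metis
    show ?thesis
      by (rule exI[of _ z], rule exI[of _ u], rule exI[of _ v], rule exI[of _ a], rule exI[of _ b])
        (use z le a b in blast)
  qed
  then obtain z u v a b where z: "\<And>j. z j (k j) = xs j"
    and run: "\<And>j. euler_run (n j) (k j) (z j) (u j) (v j)"
    and ab: "\<And>j i. a j i \<in> U" "\<And>j i. b j i \<in> V"
    and near: "\<And>j i. dist (a j i) (u j i) < inverse (real (Suc (n j)))"
      "\<And>j i. dist (b j i) (v j i) < inverse (real (Suc (n j)))"
    and le: "\<And>j i. k j \<le> i \<and> i \<le> Suc (n j) \<Longrightarrow> \<rho> (W (n j) i (z j i)) (W (n j) (k j) (xs j))"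
    by metis
  have abPQ: "\<And>j i. a j i \<in> P" "\<And>j i. b j i \<in> Q" using ab sub by blast+
  have zk: "(\<lambda>j. z j (k j)) \<longlonglongrightarrow> x" using xs z by simp
  have t'T: "t' \<in> {0..T}" using t t' by auto
  have eps: "(\<lambda>j. inverse (real (Suc (n j)))) \<longlonglongrightarrow> 0"
    by (rule filterlim_compose[OF LIMSEQ_inverse_real_of_nat n])
  obtain y r where r: "strict_mono r"
    and y: "y \<in> mtopology_of (path_space T) closure_of
       {y. \<exists>j. is_motion f g T t x (\<lambda>s. a j (cell (n j) s)) (\<lambda>s. b j (cell (n j) s)) y}"
    and lim: "\<And>m t'. \<lbrakk>t' \<in> {0..T}; \<And>j. k j \<le> m j \<and> m j \<le> Suc (n j); (\<lambda>j. grid (n j) (m j)) \<longlonglongrightarrow> t'\<rbrakk>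
       \<Longrightarrow> (\<lambda>j. z (r j) (m (r j))) \<longlonglongrightarrow> y t'"
    by (rule euler_runs_accumulate[OF t n k tk zk run abPQ near eps]) blast
  have "\<exists>m. k j \<le> m \<and> m \<le> Suc (n j) \<and> \<bar>grid (n j) m - t'\<bar> \<le> \<bar>grid (n j) (k j) - t\<bar> + step (n j)" for j
    using grid_point_near[OF t'T k[of j], of t] t' by (metis atLeastAtMost_iff)
  then obtain m where m: "\<And>j. k j \<le> m j \<and> m j \<le> Suc (n j)"
    and near: "\<And>j. \<bar>grid (n j) (m j) - t'\<bar> \<le> \<bar>grid (n j) (k j) - t\<bar> + step (n j)" by metis
  have "(\<lambda>j. grid (n j) (m j) - t') \<longlonglongrightarrow> 0"
  proof (rule Lim_null_comparison)
    have "(\<lambda>j. \<bar>grid (n j) (k j) - t\<bar> + step (n j)) \<longlonglongrightarrow> \<bar>t - t\<bar> + 0"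
      by (intro tendsto_intros tk step_tendsto_0 n)
    then show "(\<lambda>j. \<bar>grid (n j) (k j) - t\<bar> + step (n j)) \<longlonglongrightarrow> 0" by simp
  qed (use near in auto)
  then have tm: "(\<lambda>j. grid (n j) (m j)) \<longlonglongrightarrow> t'" by (simp add: LIM_zero_iff)
  have nr: "filterlim (\<lambda>j. n (r j)) at_top sequentially"
    by (rule filterlim_compose[OF n filterlim_subseq[OF r]])
  have tmr: "(\<lambda>j. grid (n (r j)) (m (r j))) \<longlonglongrightarrow> t'"
    using LIMSEQ_subseq_LIMSEQ[OF tm r] by (simp add: o_def)
  have zmr: "(\<lambda>j. z (r j) (m (r j))) \<longlonglongrightarrow> y t'" by (rule lim[OF t'T m tm])
  obtain r' w where r': "strict_mono r'"
    and W': "(\<lambda>j. W (n (r (r' j))) (m (r (r' j))) (z (r (r' j)) (m (r (r' j))))) \<longlonglongrightarrow> \<sigma> (w T)"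
    by (rule values_accumulate[OF t'T nr _ tmr zmr]) (use m in auto)
  have rr': "strict_mono (r \<circ> r')" by (rule strict_mono_o[OF r r'])
  have "y \<in> mtopology_of (path_space T) closure_of
      {y. \<exists>n a b. range a \<subseteq> U \<and> range b \<subseteq> V \<and>
         is_motion f g T t x (\<lambda>s. a (cell n s)) (\<lambda>s. b (cell n s)) y}"
    by (rule subsetD[OF closure_of_mono y]) (use ab in blast)
  moreover have "\<sigma> (w T) \<in> S t' (y t')"
    by (rule S_I[OF filterlim_compose[OF nr filterlim_subseq[OF r']] _ _ _ W'])
      (use m LIMSEQ_subseq_LIMSEQ[OF tmr r'] LIMSEQ_subseq_LIMSEQ[OF zmr r'] in \<open>auto simp: o_def\<close>)
  moreover have "\<rho> (\<sigma> (w T)) J"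
  proof -
    have "(\<sigma> (w T), J) \<in> {(p, q). \<rho> p q}"
    proof (rule Lim_in_closed_set[OF \<rho>(3)])
      show "(\<lambda>j. (W (n (r (r' j))) (m (r (r' j))) (z (r (r' j)) (m (r (r' j)))),
          W (n (r (r' j))) (k (r (r' j))) (xs (r (r' j))))) \<longlonglongrightarrow> (\<sigma> (w T), J)"
        by (intro tendsto_Pair W') (use LIMSEQ_subseq_LIMSEQ[OF W rr'] in \<open>simp add: o_def\<close>)
    qed (use le[OF m] in auto)
    then show ?thesis by simp
  qed
  ultimately show ?thesis by blast
qed

text \<open>A constant deviation \<open>u\<close> is imitated in the discrete game by the net point \<open>u' n\<close>, which the second
player punishes at every step. The approximating motions use \<open>u\<close> itself.\<close>
lemma S_deviation1:
  assumes t: "t \<in> {0..T}" and t': "t' \<in> {t..T}" and J: "J \<in> S t x" and u: "u \<in> P"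
  shows "\<exists>y\<in>Sol2 f g T Q t x u. \<exists>J'\<in>S t' (y t'). fst J' \<le> fst J"
proof -
  have "\<exists>u'. u' \<in> PN n \<and> dist u u' < inverse (real (Suc n))" for n
    using dense_P[OF u] by blast
  then obtain u' where u': "\<And>n. u' n \<in> PN n" "\<And>n. dist u (u' n) < inverse (real (Suc n))"
    by metis
  then have u'P: "u' n \<in> P" for n using nets(1)[of n] by blast
  have "\<exists>y\<in>mtopology_of (path_space T) closure_of
      {y. \<exists>n a b. range a \<subseteq> {u} \<and> range b \<subseteq> Q \<and>
         is_motion f g T t x (\<lambda>s. a (cell n s)) (\<lambda>s. b (cell n s)) y}.
    \<exists>J'\<in>S t' (y t'). fst J' \<le> fst J"
  proof (rule S_stable[OF t t' J, where A="\<lambda>n. {u' n}" and B=QN and \<rho>="\<lambda>p q. fst p \<le> fst q"])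
    show "closed {(p :: real \<times> real, q :: real \<times> real). fst p \<le> fst q}"
      unfolding case_prod_unfold by (intro closed_Collect_le continuous_intros)
    show "\<exists>b\<in>Q. dist b v < inverse (real (Suc n))" if "v \<in> QN n" for n v
      using nets(2)[of n] that by (intro bexI[of _ v]) auto
  qed (use W_punish1[OF _ u'(1)] u' u'P nets(2) u in \<open>auto simp: reflp_def transp_def\<close>)
  moreover have "{y. \<exists>n a b. range a \<subseteq> {u} \<and> range b \<subseteq> Q \<and>
         is_motion f g T t x (\<lambda>s. a (cell n s)) (\<lambda>s. b (cell n s)) y} \<subseteq>
      {y. \<exists>v\<in>controls T Q. is_motion f g T t x (\<lambda>_. u) v y}"
  proof clarify
    fix y n a b
    assume "range a \<subseteq> {u}" "range b \<subseteq> Q"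
      and mot: "is_motion f g T t x (\<lambda>s. a (cell n s)) (\<lambda>s. b (cell n s)) y"
    moreover from this have "a i = u" "b i \<in> Q" for i by auto
    ultimately show "\<exists>v\<in>controls T Q. is_motion f g T t x (\<lambda>_. u) v y"
      using piecewise_constant_control[of b Q n] by auto
  qed
  ultimately show ?thesis
    unfolding Sol2_def by (meson closure_of_mono subsetD)
qed

lemma S_deviation2:
  assumes t: "t \<in> {0..T}" and t': "t' \<in> {t..T}" and J: "J \<in> S t x" and v: "v \<in> Q"
  shows "\<exists>y\<in>Sol1 f g T P t x v. \<exists>J'\<in>S t' (y t'). snd J' \<le> snd J"
proof -
  have "\<exists>v'. v' \<in> QN n \<and> dist v v' < inverse (real (Suc n))" for n
    using dense_Q[OF v] by blast
  then obtain v' where v': "\<And>n. v' n \<in> QN n" "\<And>n. dist v (v' n) < inverse (real (Suc n))"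
    by metis
  then have v'Q: "v' n \<in> Q" for n using nets(2)[of n] by blast
  have "\<exists>y\<in>mtopology_of (path_space T) closure_of
      {y. \<exists>n a b. range a \<subseteq> P \<and> range b \<subseteq> {v} \<and>
         is_motion f g T t x (\<lambda>s. a (cell n s)) (\<lambda>s. b (cell n s)) y}.
    \<exists>J'\<in>S t' (y t'). snd J' \<le> snd J"
  proof (rule S_stable[OF t t' J, where A=PN and B="\<lambda>n. {v' n}" and \<rho>="\<lambda>p q. snd p \<le> snd q"])
    show "closed {(p :: real \<times> real, q :: real \<times> real). snd p \<le> snd q}"
      unfolding case_prod_unfold by (intro closed_Collect_le continuous_intros)
    show "\<exists>a\<in>P. dist a u < inverse (real (Suc n))" if "u \<in> PN n" for n u
      using nets(1)[of n] that by (intro bexI[of _ u]) auto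
  qed (use W_punish2[OF _ v'(1)] v' v'Q nets(1) v in \<open>auto simp: reflp_def transp_def\<close>)
  moreover have "{y. \<exists>n a b. range a \<subseteq> P \<and> range b \<subseteq> {v} \<and>
         is_motion f g T t x (\<lambda>s. a (cell n s)) (\<lambda>s. b (cell n s)) y} \<subseteq>
      {y. \<exists>u\<in>controls T P. is_motion f g T t x u (\<lambda>_. v) y}"
  proof clarify
    fix y n a b
    assume "range a \<subseteq> P" "range b \<subseteq> {v}"
      and mot: "is_motion f g T t x (\<lambda>s. a (cell n s)) (\<lambda>s. b (cell n s)) y"
    moreover from this have "a i \<in> P" "b i = v" for i by auto
    ultimately show "\<exists>u\<in>controls T P. is_motion f g T t x u (\<lambda>_. v) y"
      using piecewise_constant_control[of a P n] by auto
  qed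
  ultimately show ?thesis
    unfolding Sol1_def by (meson closure_of_mono subsetD)
qed

lemma S_equilibrium_motion:
  assumes t: "t \<in> {0..T}" and t': "t' \<in> {t..T}" and J: "J \<in> S t x"
  shows "\<exists>y\<in>Sol f g T P Q t x. J \<in> S t' (y t')"
proof -
  have "\<exists>y\<in>mtopology_of (path_space T) closure_of
      {y. \<exists>n a b. range a \<subseteq> P \<and> range b \<subseteq> Q \<and>
         is_motion f g T t x (\<lambda>s. a (cell n s)) (\<lambda>s. b (cell n s)) y}.
    \<exists>J'\<in>S t' (y t'). J' = J"
  proof (rule S_stable[OF t t' J, where A=PN and B=QN and \<rho>="(=)"])
    show "closed {(p :: real \<times> real, q :: real \<times> real). p = q}"
      unfolding case_prod_unfold by (intro closed_Collect_eq continuous_intros)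
    show "\<exists>a\<in>P. dist a u < inverse (real (Suc n))" if "u \<in> PN n" for n u
      using nets(1)[of n] that by (intro bexI[of _ u]) auto
    show "\<exists>b\<in>Q. dist b v < inverse (real (Suc n))" if "v \<in> QN n" for n v
      using nets(2)[of n] that by (intro bexI[of _ v]) auto
  qed (use W_attained nets in \<open>auto simp: reflp_def transp_def\<close>)
  moreover have "{y. \<exists>n a b. range a \<subseteq> P \<and> range b \<subseteq> Q \<and>
         is_motion f g T t x (\<lambda>s. a (cell n s)) (\<lambda>s. b (cell n s)) y} \<subseteq>
      {y. \<exists>u\<in>controls T P. \<exists>v\<in>controls T Q. is_motion f g T t x u v y}"
  proof clarify
    fix y n a b
    assume "range a \<subseteq> P" "range b \<subseteq> Q"
      and mot: "is_motion f g T t x (\<lambda>s. a (cell n s)) (\<lambda>s. b (cell n s)) y"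
    moreover from this have "a i \<in> P" "b i \<in> Q" for i by auto
    ultimately show "\<exists>u\<in>controls T P. \<exists>v\<in>controls T Q. is_motion f g T t x u v y"
      using piecewise_constant_control[of a P n] piecewise_constant_control[of b Q n] by blast
  qed
  ultimately show ?thesis
    unfolding Sol_def by (meson closure_of_mono subsetD)
qed

end

section \<open>Existence of the multivalued function\<close>

theorem theorem5p2:
  fixes T :: real
    and P :: "'p::metric_space set" and Q :: "'q::metric_space set"
    and f :: "real \<Rightarrow> real^'n \<Rightarrow> 'p \<Rightarrow> real^'n"
    and g :: "real \<Rightarrow> real^'n \<Rightarrow> 'q \<Rightarrow> real^'n"
    and \<sigma>1 \<sigma>2 :: "real^'n \<Rightarrow> real"
  assumes "0 \<le> T"
    and "compact P" and "P \<noteq> {}" and "compact Q" and "Q \<noteq> {}"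
    and "continuous_on ({0..T} \<times> UNIV \<times> P) (\<lambda>(t, x, u). f t x u)"
    and "continuous_on ({0..T} \<times> UNIV \<times> Q) (\<lambda>(t, x, v). g t x v)"
    and "continuous_on UNIV \<sigma>1" and "continuous_on UNIV \<sigma>2"
    and "lipschitz_in_state T P f" and "lipschitz_in_state T Q g"
    and "sublinear_growth T P f" and "sublinear_growth T Q g"
  shows "\<exists>S :: real \<Rightarrow> real^'n \<Rightarrow> (real \<times> real) set.
    upper_semicontinuous_mv T S \<and>
    (\<forall>t\<in>{0..T}. \<forall>x. S t x \<noteq> {}) \<and>
    (\<forall>x. S T x = {(\<sigma>1 x, \<sigma>2 x)}) \<and>
    (\<forall>t\<in>{0..T}. \<forall>x. \<forall>(J1, J2)\<in>S t x. \<forall>u\<in>P. \<forall>t'\<in>{t..T}.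
       \<exists>y\<in>Sol2 f g T Q t x u. \<exists>(J1', J2')\<in>S t' (y t'). J1 \<ge> J1') \<and>
    (\<forall>t\<in>{0..T}. \<forall>x. \<forall>(J1, J2)\<in>S t x. \<forall>v\<in>Q. \<forall>t'\<in>{t..T}.
       \<exists>y\<in>Sol1 f g T P t x v. \<exists>(J1', J2')\<in>S t' (y t'). J2 \<ge> J2') \<and>
    (\<forall>t\<in>{0..T}. \<forall>x. \<forall>(J1, J2)\<in>S t x. \<forall>t'\<in>{t..T}.
       \<exists>y\<in>Sol f g T P Q t x. (J1, J2) \<in> S t' (y t'))"
proof -
  obtain Lf Lg where Lf: "\<And>t u. \<lbrakk>t \<in> {0..T}; u \<in> P\<rbrakk> \<Longrightarrow> Lf-lipschitz_on UNIV (\<lambda>x. f t x u)"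
    and Lg: "\<And>t v. \<lbrakk>t \<in> {0..T}; v \<in> Q\<rbrakk> \<Longrightarrow> Lg-lipschitz_on UNIV (\<lambda>x. g t x v)"
    using assms(10,11) unfolding lipschitz_in_state_def by blast
  obtain Cf Cg where Cf: "\<And>t x u. \<lbrakk>t \<in> {0..T}; u \<in> P\<rbrakk> \<Longrightarrow> norm (f t x u) \<le> Cf * (1 + norm x)"
    and Cg: "\<And>t x v. \<lbrakk>t \<in> {0..T}; v \<in> Q\<rbrakk> \<Longrightarrow> norm (g t x v) \<le> Cg * (1 + norm x)"
    using assms(12,13) unfolding sublinear_growth_def by blast
  define L where "L = max 0 (max Lf Lg)"
  define C where "C = max 0 (max Cf Cg)"
  interpret controlled_system T P Q f g L C
  proof
    have le: "Lf \<le> L" "Lg \<le> L" "Cf \<le> C" "Cg \<le> C" by (auto simp: L_def C_def)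
    show "norm (f s x u - f s y u) \<le> L * norm (x - y)" if "s \<in> {0..T}" "u \<in> P" for s x y u
    proof -
      have "norm (f s x u - f s y u) \<le> Lf * norm (x - y)"
        using lipschitz_onD[OF Lf[OF that], of x y] by (simp add: dist_norm)
      also have "\<dots> \<le> L * norm (x - y)" by (intro mult_right_mono le) simp
      finally show ?thesis .
    qed
    show "norm (g s x v - g s y v) \<le> L * norm (x - y)" if "s \<in> {0..T}" "v \<in> Q" for s x y v
    proof -
      have "norm (g s x v - g s y v) \<le> Lg * norm (x - y)"
        using lipschitz_onD[OF Lg[OF that], of x y] by (simp add: dist_norm)
      also have "\<dots> \<le> L * norm (x - y)" by (intro mult_right_mono le) simp
      finally show ?thesis .
    qed
    show "norm (f s x u) \<le> C * (1 + norm x)" if "s \<in> {0..T}" "u \<in> P" for s x u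
      by (rule order_trans[OF Cf[OF that]]) (intro mult_right_mono le; simp)
    show "norm (g s x v) \<le> C * (1 + norm x)" if "s \<in> {0..T}" "v \<in> Q" for s x v
      by (rule order_trans[OF Cg[OF that]]) (intro mult_right_mono le; simp)
  qed (use assms in \<open>auto simp: L_def C_def\<close>)
  have pos: "inverse (real (Suc n)) > 0" for n by simp
  obtain PN where PN: "\<And>n. finite (PN n) \<and> PN n \<noteq> {} \<and> PN n \<subseteq> P \<and>
      (\<forall>u\<in>P. \<exists>u'\<in>PN n. dist u u' < inverse (real (Suc n)))"
    using finite_net[OF assms(2,3) pos] by metis
  obtain QN where QN: "\<And>n. finite (QN n) \<and> QN n \<noteq> {} \<and> QN n \<subseteq> Q \<and>
      (\<forall>v\<in>Q. \<exists>v'\<in>QN n. dist v v' < inverse (real (Suc n)))"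
    using finite_net[OF assms(4,5) pos] by metis
  have "\<forall>n. \<exists>W. W (Suc n) = (\<lambda>x. (\<sigma>1 x, \<sigma>2 x)) \<and> (\<forall>k<Suc n. \<forall>x.
    (\<exists>u\<in>PN n. \<exists>v\<in>QN n. W (Suc k) (euler_move n k x u v) = W k x) \<and>
    (\<forall>u\<in>PN n. \<exists>v\<in>QN n. fst (W (Suc k) (euler_move n k x u v)) \<le> fst (W k x)) \<and>
    (\<forall>v\<in>QN n. \<exists>u\<in>PN n. snd (W (Suc k) (euler_move n k x u v)) \<le> snd (W k x)))"
    using PN QN by (intro allI backward_induction) auto
  from choice[OF this] obtain W where W: "\<And>n. W n (Suc n) = (\<lambda>x. (\<sigma>1 x, \<sigma>2 x)) \<and> (\<forall>k<Suc n. \<forall>x.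
    (\<exists>u\<in>PN n. \<exists>v\<in>QN n. W n (Suc k) (euler_move n k x u v) = W n k x) \<and>
    (\<forall>u\<in>PN n. \<exists>v\<in>QN n. fst (W n (Suc k) (euler_move n k x u v)) \<le> fst (W n k x)) \<and>
    (\<forall>v\<in>QN n. \<exists>u\<in>PN n. snd (W n (Suc k) (euler_move n k x u v)) \<le> snd (W n k x)))"
    by blast
  interpret discrete_values T P Q f g L C "\<lambda>x. (\<sigma>1 x, \<sigma>2 x)" PN QN W
  proof
    show "continuous_on UNIV (\<lambda>x. (\<sigma>1 x, \<sigma>2 x))"
      by (intro continuous_on_Pair assms)
  qed (use PN QN W in \<open>auto simp: less_Suc_eq_le\<close>)
  show ?thesis
  proof (intro exI[of _ S] conjI)
    show "\<forall>t\<in>{0..T}. \<forall>x. \<forall>(J1, J2)\<in>S t x. \<forall>u\<in>P. \<forall>t'\<in>{t..T}.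
       \<exists>y\<in>Sol2 f g T Q t x u. \<exists>(J1', J2')\<in>S t' (y t'). J1 \<ge> J1'"
      using S_deviation1 by (fastforce simp: case_prod_unfold)
    show "\<forall>t\<in>{0..T}. \<forall>x. \<forall>(J1, J2)\<in>S t x. \<forall>v\<in>Q. \<forall>t'\<in>{t..T}.
       \<exists>y\<in>Sol1 f g T P t x v. \<exists>(J1', J2')\<in>S t' (y t'). J2 \<ge> J2'"
      using S_deviation2 by (fastforce simp: case_prod_unfold)
    show "\<forall>t\<in>{0..T}. \<forall>x. \<forall>(J1, J2)\<in>S t x. \<forall>t'\<in>{t..T}.
       \<exists>y\<in>Sol f g T P Q t x. (J1, J2) \<in> S t' (y t')"
      using S_equilibrium_motion by (simp add: case_prod_unfold)
  qed (use S_upper_semicontinuous S_nonempty S_final in auto)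
qed

end
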